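(* For every $n\ge 1$ there is a constant $c_n>0$ depending only on $n$ such that the following holds. Let $0<\delta<1$, let $1\le p<\frac{n}{\delta}$, let $w\in A_1$, and define the exponents $p_\delta^*$ and $p_{\delta,w}^*$ by $$\frac1p-\frac1{p_\delta^*}=\frac{\delta}{n},\qquad \frac1p-\frac{1}{p_{\delta,w}^*}=\frac{\delta}{n}\,\frac{1}{1+\log [w]_{A_1}}.$$ Then, for every cube $Q$ in $\mathbb{R}^n$ and every $u\in L^1_{\mathrm{loc}}(\mathbb{R}^n)$, $$\inf_{c\in\mathbb{R}}\left(\frac{1}{w(Q)}\int_Q |u(x)-c|^{p_{\delta,w}^*}\,w(x)\,dx\right)^{\frac{1}{p_{\delta,w}^*}}\le c_n\,p_\delta^*\,(1-\delta)^{\frac1p}\,[w]_{A_1}^{1+\frac1p}\,\ell(Q)^\delta\left(\frac{1}{w(Q)}\int_Q\int_Q\frac{|u(x)-u(y)|^p}{|x-y|^{n+p\delta}}\,dy\,w(x)\,dx\right)^{\frac1p}.$$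
   Context: A cube $Q\subset\mathbb{R}^n$ is a cartesian product of $n$ intervals of the same side length $\ell(Q)$. A weight is a function $w\in L^1_{\mathrm{loc}}(\mathbb{R}^n)$ with $w(x)>0$ for almost every $x$; $w(E)=\int_E w\,dx$. A weight $w$ is in $A_1$ if there is $C>0$ with $\frac1{|Q|}\int_Q w\,dx\le C\,\operatorname{ess\,inf}_{x\in Q}w(x)$ for every cube $Q$; $[w]_{A_1}$ is the smallest such $C$. *)

theory Defs
  imports "HOL-Analysis.Analysis"
begin

text \<open>
  Cubes may be open, closed or half-open, independently in each coordinate; \<open>l\<close> is the
  (positive) side length.
\<close>

definition is_cube :: "real \<Rightarrow> (real ^ 'n) set \<Rightarrow> bool" where
  "is_cube l Q \<longleftrightarrow> 0 < l \<and>
     (\<exists>(a :: real ^ 'n) (I :: 'n \<Rightarrow> real set).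
        (\<forall>i. {a $ i <..< a $ i + l} \<subseteq> I i \<and> I i \<subseteq> {a $ i .. a $ i + l}) \<and>
        Q = {x. \<forall>i. x $ i \<in> I i})"

definition locally_integrable :: "(real ^ 'n \<Rightarrow> real) \<Rightarrow> bool" where
  "locally_integrable f \<longleftrightarrow> (\<forall>K. compact K \<longrightarrow> set_integrable lebesgue K f)"

definition weight :: "(real ^ 'n \<Rightarrow> real) \<Rightarrow> bool" where
  "weight w \<longleftrightarrow> locally_integrable w \<and> (AE x in lebesgue. 0 < w x)"

definition weighted_measure :: "(real ^ 'n \<Rightarrow> real) \<Rightarrow> (real ^ 'n) set \<Rightarrow> ennreal" where
  "weighted_measure w E = (\<integral>\<^sup>+x\<in>E. ennreal (w x) \<partial>lebesgue)"

text \<open>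
  The dual of \<open>esssup\<close> from \<open>HOL-Probability.Essential_Supremum\<close>, for nonnegative functions: the
  largest \<open>c\<close> with \<open>c \<le> f x\<close> for almost every \<open>x \<in> E\<close>.
\<close>

definition ess_inf_on :: "(real ^ 'n) set \<Rightarrow> (real ^ 'n \<Rightarrow> real) \<Rightarrow> ennreal" where
  "ess_inf_on E f = Liminf (ae_filter (lebesgue_on E)) (\<lambda>x. ennreal (f x))"

definition A1_bound :: "(real ^ 'n \<Rightarrow> real) \<Rightarrow> real \<Rightarrow> bool" where
  "A1_bound w C \<longleftrightarrow> 0 < C \<and>
     (\<forall>Q l. is_cube l Q \<longrightarrow>
        weighted_measure w Q / emeasure lebesgue Q \<le> ennreal C * ess_inf_on Q w)"

definition A1_weight :: "(real ^ 'n \<Rightarrow> real) \<Rightarrow> bool" where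
  "A1_weight w \<longleftrightarrow> weight w \<and> (\<exists>C. A1_bound w C)"

text \<open>For an \<open>A1_weight\<close> the infimum is attained, so this is the smallest admissible constant.\<close>

definition A1_const :: "(real ^ 'n \<Rightarrow> real) \<Rightarrow> real" where
  "A1_const w = Inf {C. A1_bound w C}"

text \<open>Real powers on \<open>[0,\<infinity>]\<close>; only meant for exponents \<open>a > 0\<close>.\<close>

definition ennreal_powr :: "ennreal \<Rightarrow> real \<Rightarrow> ennreal" where
  "ennreal_powr x a = (if x = top then top else ennreal (enn2real x powr a))"

end

theory Submission
  imports Defs
begin

text \<open>Write \<open>q\<close> for the exponent \<open>p\<^sup>*\<close> with \<open>1/p - 1/q = \<delta>/n\<close>, \<open>K\<close> for the \<open>A\<^sub>1\<close> constant of \<open>w\<close>, and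
  \<open>g x\<close> for the inner integral on the right, so that the energy is \<open>\<integral>\<^sub>Q g w\<close>. The strategy is to prove the
  inequality with the larger exponent \<open>q\<close> on the left and with the mean of \<open>u\<close> over \<open>Q\<close> as the constant
  \<open>c\<close>; the smaller exponent of the theorem then costs a factor \<open>2\<close>, since
  \<open>z\<^sup>r \<le> 1 + z\<^sup>q\<close> for \<open>r \<le> q\<close>. The proof gives the power \<open>K\<^bsup>1/p\<^esup>\<close>, which is at most
  the power in the theorem because \<open>K \<ge> 1\<close>.

  The factor \<open>(1 - \<delta>)\<^bsup>1/p\<^esup>\<close> enters through an unweighted Poincare inequality
  (\<open>fractional_poincare_convex\<close>). Put \<open>F h = \<integral> |u(x + h) - u(x)|\<^sup>p dx\<close>. Convexity gives
  \<open>F(2h) \<le> 2\<^sup>p F(h)\<close>, so every scale carries at least the proportion \<open>2\<^bsup>-p(1 - \<delta>)\<^esup>\<close> of the energy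
  of the next larger one. Hence a single scale carries at most the proportion
  \<open>1 - 2\<^bsup>-p(1 - \<delta>)\<^esup> \<le> p(1 - \<delta>)\<close> of the total energy.

  For \<open>x\<close> in \<open>Q\<close>, consider the means \<open>m\<^sub>k\<close> of \<open>u\<close> over the dyadic cells of side \<open>l/2\<^sup>k\<close> that contain
  \<open>x\<close>. By the Poincare inequality, \<open>|m\<^sub>k - m\<^sub>k\<^sub>+\<^sub>1|\<close> is at most
  \<open>D (1 - \<delta>)\<^bsup>1/p\<^esup> (l/2\<^sup>k)\<^sup>\<delta>\<close> times the \<open>p\<close>-th root of the mean of \<open>g\<close> over the \<open>k\<close>-th cell. At the fine
  scales this mean is at most the dyadic maximal function \<open>Mg(x)\<close>. At the coarse scales it is at most
  \<open>2\<^bsup>kn\<^esup>\<close> times the mean of \<open>g\<close> over \<open>Q\<close>, which by the \<open>A\<^sub>1\<close> condition is at most \<open>K\<close> times the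
  weighted mean. The two geometric sums balance (\<open>pointwise_bound\<close>), and the coarse one,
  with ratio \<open>2\<^bsup>n/q\<^esup>\<close>, produces the factor \<open>q\<close>. The fine sum, with ratio \<open>2\<^bsup>-\<delta>\<^esup>\<close>, would produce
  \<open>1/\<delta>\<close>. For \<open>\<delta> \<le> 1/2\<close> it is therefore replaced by the direct estimate
  \<open>|u(x) - m\<^sub>k| \<le> C (l/2\<^sup>k)\<^sup>\<delta> g(x)\<^bsup>1/p\<^esup>\<close>, which is harmless because \<open>1 - \<delta>\<close> is then bounded below.
  The same estimate shows \<open>m\<^sub>k \<rightarrow> u(x)\<close> wherever \<open>g(x)\<close> is finite.

  The dyadic maximal function is of weak type \<open>(1,1)\<close> for \<open>w\<close> with constant \<open>K\<close> (\<open>maximal_weak_type\<close>),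
  so the pointwise bound becomes a weak-type inequality with exponent \<open>q\<close> (\<open>weak_type\<close>). Maz'ya's
  truncation turns it into a strong-type inequality: \<open>weak_type\<close> is applied to the dyadic layers of
  \<open>|u - m\<^sub>0|\<close>, whose energies add up to at most that of \<open>u\<close> (\<open>strong_type\<close>).\<close>

section \<open>The Bourgain--Brezis--Mironescu factor in the fractional Poincare inequality\<close>

lemma nn_integral_lborel_translate:
  fixes f :: "'a::euclidean_space \<Rightarrow> ennreal"
  assumes [measurable]: "f \<in> borel_measurable borel"
  shows "(\<integral>\<^sup>+x. f (t + x) \<partial>lborel) = (\<integral>\<^sup>+x. f x \<partial>lborel)"
proof -
  have "(\<integral>\<^sup>+x. f x \<partial>lborel) = (\<integral>\<^sup>+x. f x \<partial>(distr lborel borel ((+) t)))"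
    by (simp add: lborel_distr_plus)
  also have "\<dots> = (\<integral>\<^sup>+x. f (t + x) \<partial>lborel)"
    by (subst nn_integral_distr) auto
  finally show ?thesis ..
qed

lemma nn_integral_lborel_dilate:
  fixes f :: "'a::euclidean_space \<Rightarrow> ennreal"
  assumes [measurable]: "f \<in> borel_measurable borel" and c: "c > 0"
  shows "(\<integral>\<^sup>+x. f x \<partial>lborel) = ennreal (c ^ DIM('a)) * (\<integral>\<^sup>+x. f (c *\<^sub>R x) \<partial>lborel)"
proof -
  have "(\<integral>\<^sup>+x. f x \<partial>lborel)
      = (\<integral>\<^sup>+x. f x \<partial>(density (distr lborel borel (\<lambda>x. 0 + c *\<^sub>R x)) (\<lambda>_. \<bar>c\<bar> ^ DIM('a))))"
    using lborel_affine[of c "0::'a"] c by simp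
  also have "\<dots> = ennreal (c ^ DIM('a)) * (\<integral>\<^sup>+x. f (c *\<^sub>R x) \<partial>lborel)"
    using c by (simp add: nn_integral_density nn_integral_distr nn_integral_cmult)
  finally show ?thesis .
qed

text \<open>The weight \<open>G h = (2R)\<^sup>a - |h|\<^sup>a\<close> on the ball of radius \<open>R\<close> satisfies \<open>G h \<ge> |h|\<^sup>a + G (2h)\<close> there. Let \<open>m\<close> be the measure
  \<open>F h |h|\<^bsup>-a\<^esup> dh\<close>. The substitution \<open>h \<mapsto> 2h\<close> and the doubling of \<open>F\<close> show that \<open>\<integral> G(2h) dm\<close> is at least
  \<open>\<theta> \<integral> G dm\<close> with \<open>\<theta> = 2\<^bsup>-p(1 - \<delta>)\<^esup>\<close>; therefore \<open>\<integral> F \<le> (1 - \<theta>) \<integral> G dm\<close>, and \<open>G \<le> (2R)\<^sup>a\<close>.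
  This is the only source of the factor \<open>1 - \<delta>\<close>.\<close>

lemma fractional_scaling_gain:
  fixes F :: "'a::euclidean_space \<Rightarrow> ennreal"
  assumes [measurable]: "F \<in> borel_measurable borel"
    and F0: "F 0 = 0" and F_dbl: "\<And>h. F (2 *\<^sub>R h) \<le> ennreal (2 powr p) * F h"
    and F_supp: "\<And>h. norm h > R \<Longrightarrow> F h = 0"
    and p: "1 \<le> p" and d: "0 < \<delta>" "\<delta> < 1" and R: "0 < R"
    and a: "a = real DIM('a) + p * \<delta>"
  shows "(\<integral>\<^sup>+h. F h \<partial>lborel)
    \<le> ennreal (p * (1 - \<delta>) * (2 * R) powr a) * (\<integral>\<^sup>+h. F h * ennreal (1 / norm h powr a) \<partial>lborel)"
proof -
  define S where "S = (\<integral>\<^sup>+h. F h * ennreal (1 / norm h powr a) \<partial>lborel)"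
  define \<theta> where "\<theta> = 2 powr (- (p * (1 - \<delta>)))"
  define G where "G h = (if norm h \<le> R then (2 * R) powr a - norm h powr a else 0)" for h :: 'a
  have [measurable]: "G \<in> borel_measurable borel" unfolding G_def by measurable
  have a1: "1 \<le> a" using a p d by (simp add: Suc_leI add_increasing2)
  have twoa: "2 \<le> 2 powr a" using powr_mono[of 1 a 2] a1 by simp
  have G_nonneg: "0 \<le> G h" for h
    unfolding G_def using R a1 by (auto intro!: powr_mono2)
  have G_le: "G h \<le> (2 * R) powr a" for h unfolding G_def by auto
  have G_step: "norm h powr a + G (2 *\<^sub>R h) \<le> G h" if h: "norm h \<le> R" for h
  proof -
    have e: "(2 * norm h) powr a = 2 powr a * norm h powr a" by (simp add: powr_mult)
    have e': "(2 * R) powr a = 2 powr a * R powr a" using R by (simp add: powr_mult)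
    have m: "norm h powr a \<le> R powr a" using h a1 by (intro powr_mono2) auto
    have "2 * norm h powr a \<le> 2 powr a * norm h powr a" using twoa by (intro mult_right_mono) auto
    moreover have "2 * norm h powr a \<le> 2 powr a * R powr a" using twoa m by (intro mult_mono) auto
    ultimately show ?thesis using h by (auto simp: G_def e e')
  qed
  define I where "I = (\<integral>\<^sup>+h. ennreal (G h) * (F h * ennreal (1 / norm h powr a)) \<partial>lborel)"
  define I2 where "I2 = (\<integral>\<^sup>+h. ennreal (G (2 *\<^sub>R h)) * (F h * ennreal (1 / norm h powr a)) \<partial>lborel)"
  have I_le: "I \<le> ennreal ((2 * R) powr a) * S"
    unfolding I_def S_def by (subst nn_integral_cmult[symmetric], simp)
      (intro nn_integral_mono mult_right_mono ennreal_leI G_le, auto)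
  have th: "1 - p * (1 - \<delta>) \<le> \<theta>" "0 < \<theta>"
  proof -
    have "1 + (- (p * (1 - \<delta>)) * ln 2) \<le> \<theta>"
      unfolding \<theta>_def powr_def using exp_ge_add_one_self[of "- (p * (1 - \<delta>)) * ln 2"] by simp
    moreover have "p * (1 - \<delta>) * ln 2 \<le> p * (1 - \<delta>) * 1"
      using ln_2_less_1 p d by (intro mult_left_mono) auto
    ultimately show "1 - p * (1 - \<delta>) \<le> \<theta>" by (simp only: minus_mult_left [symmetric] mult_1_right)
  qed (simp add: \<theta>_def)
  have I_scale: "ennreal \<theta> * I \<le> I2"
  proof -
    have "I = ennreal (2 ^ DIM('a)) * (\<integral>\<^sup>+h. ennreal (G (2 *\<^sub>R h)) *
        (F (2 *\<^sub>R h) * ennreal (1 / norm (2 *\<^sub>R h) powr a)) \<partial>lborel)"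
      unfolding I_def by (subst nn_integral_lborel_dilate[of _ 2]) auto
    also have "\<dots> \<le> ennreal (2 ^ DIM('a)) * (\<integral>\<^sup>+h. ennreal (2 powr p * 2 powr (- a)) * (ennreal (G (2 *\<^sub>R h)) *
        (F h * ennreal (1 / norm h powr a))) \<partial>lborel)"
    proof (intro mult_left_mono nn_integral_mono)
      fix h :: 'a
      have "ennreal (1 / norm (2 *\<^sub>R h) powr a) = ennreal (2 powr (- a)) * ennreal (1 / norm h powr a)"
        by (simp add: ennreal_mult[symmetric] powr_mult powr_minus field_simps)
      then have "ennreal (G (2 *\<^sub>R h)) * (F (2 *\<^sub>R h) * ennreal (1 / norm (2 *\<^sub>R h) powr a))
        \<le> ennreal (G (2 *\<^sub>R h)) * ((ennreal (2 powr p) * F h) * (ennreal (2 powr (- a)) * ennreal (1 / norm h powr a)))"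
        using F_dbl[of h] by (intro mult_left_mono mult_mono) auto
      then show "ennreal (G (2 *\<^sub>R h)) * (F (2 *\<^sub>R h) * ennreal (1 / norm (2 *\<^sub>R h) powr a))
         \<le> ennreal (2 powr p * 2 powr (- a)) * (ennreal (G (2 *\<^sub>R h)) * (F h * ennreal (1 / norm h powr a)))"
        by (simp add: ennreal_mult mult_ac)
    qed auto
    also have "\<dots> = ennreal (2 ^ DIM('a) * (2 powr p * 2 powr (- a))) * I2"
      unfolding I2_def by (subst nn_integral_cmult) (auto simp: ennreal_mult mult.assoc)
    also have "2 ^ DIM('a) * (2 powr p * 2 powr (- a)) = 2 powr (p * (1 - \<delta>))"
      by (simp add: powr_add[symmetric] powr_realpow[symmetric] a algebra_simps)
    finally have "ennreal \<theta> * I \<le> ennreal \<theta> * (ennreal (2 powr (p * (1 - \<delta>))) * I2)"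
      by (intro mult_left_mono) auto
    also have "\<dots> = I2"
      unfolding mult.assoc[symmetric] using th
      by (subst ennreal_mult[symmetric]) (auto simp: \<theta>_def powr_minus)
    finally show ?thesis .
  qed
  have F_step: "(\<integral>\<^sup>+h. F h \<partial>lborel) + I2 \<le> I"
  proof -
    have "F h + ennreal (G (2 *\<^sub>R h)) * (F h * ennreal (1 / norm h powr a))
        \<le> ennreal (G h) * (F h * ennreal (1 / norm h powr a))" for h
    proof (cases "h = 0 \<or> norm h > R")
      case True then show ?thesis using F0 F_supp by auto
    next
      case False
      then have h: "norm h \<le> R" "norm h powr a > 0" by auto
      have "1 + G (2 *\<^sub>R h) * (1 / norm h powr a) \<le> G h * (1 / norm h powr a)"
        using divide_right_mono[OF G_step[OF h(1)], of "norm h powr a"] h(2) by (simp add: add_divide_distrib)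
      then have "ennreal (1 + G (2 *\<^sub>R h) * (1 / norm h powr a)) \<le> ennreal (G h * (1 / norm h powr a))"
        by (rule ennreal_leI)
      then have "F h * (1 + ennreal (G (2 *\<^sub>R h)) * ennreal (1 / norm h powr a))
          \<le> F h * (ennreal (G h) * ennreal (1 / norm h powr a))"
        using G_nonneg by (intro mult_left_mono) (auto simp: ennreal_mult[symmetric] simp flip: ennreal_1 ennreal_plus)
      then show ?thesis by (simp add: distrib_left mult_ac)
    qed
    then show ?thesis
      unfolding I_def I2_def by (subst nn_integral_add[symmetric]) (auto intro!: nn_integral_mono)
  qed
  \<comment> \<open>\<open>\<theta> I\<close> can be subtracted from \<open>\<integral> F + \<theta> I \<le> I\<close> only when \<open>I\<close> is finite.\<close>
  show ?thesis
  proof (cases "S = top")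
    case True
    have "0 < p * (1 - \<delta>) * (2 * R) powr a" using p d R by simp
    then show ?thesis using True unfolding S_def[symmetric] using p d R by (simp add: ennreal_mult_top)
  next
    case False
    then have "I < top" using I_le by (simp add: ennreal_mult_less_top le_less_trans less_top)
    then obtain i where i: "I = ennreal i" "0 \<le> i" by (cases I) auto
    have *: "(\<integral>\<^sup>+h. F h \<partial>lborel) + ennreal (\<theta> * i) \<le> ennreal i"
      using F_step I_scale i th by (simp add: ennreal_mult) (meson add_left_mono order_trans)
    then have "(\<integral>\<^sup>+h. F h \<partial>lborel) < top"
      by (metis ennreal_less_top order_le_less_trans le_iff_add)
    then obtain f where f: "(\<integral>\<^sup>+h. F h \<partial>lborel) = ennreal f" "0 \<le> f"
      by (cases "(\<integral>\<^sup>+h. F h \<partial>lborel)") auto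
    have "f + \<theta> * i \<le> i" using * f i th by (simp flip: ennreal_plus)
    then have "f \<le> (1 - \<theta>) * i" by (simp add: algebra_simps)
    also have "\<dots> \<le> (p * (1 - \<delta>)) * i" using th i by (intro mult_right_mono) auto
    finally have "(\<integral>\<^sup>+h. F h \<partial>lborel) \<le> ennreal (p * (1 - \<delta>)) * I"
      using f i p d by (simp add: ennreal_mult[symmetric])
    also have "\<dots> \<le> ennreal (p * (1 - \<delta>)) * (ennreal ((2 * R) powr a) * S)"
      using I_le by (intro mult_left_mono) auto
    finally show ?thesis using p d by (simp add: S_def ennreal_mult mult.assoc)
  qed
qed

lemma abs_add_powr_le:
  fixes x y :: real
  assumes p: "1 \<le> p"
  shows "\<bar>x + y\<bar> powr p \<le> 2 powr (p - 1) * (\<bar>x\<bar> powr p + \<bar>y\<bar> powr p)"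
proof (cases "x = 0 \<or> y = 0")
  case True
  have "1 * z \<le> 2 powr (p - 1) * z" if "0 \<le> z" for z :: real
    using p that by (intro mult_right_mono ge_one_powr_ge_zero) auto
  then show ?thesis using True by auto
next
  case False
  then have "((1 - 1/2) *\<^sub>R \<bar>x\<bar> + (1/2) *\<^sub>R \<bar>y\<bar>) powr p \<le> (1 - 1/2) * (\<bar>x\<bar> powr p) + (1/2) * (\<bar>y\<bar> powr p)"
    by (intro convex_onD[OF powr_convex[OF p], of "1/2" "\<bar>x\<bar>" "\<bar>y\<bar>"]) auto
  then have "((\<bar>x\<bar> + \<bar>y\<bar>) / 2) powr p \<le> (\<bar>x\<bar> powr p + \<bar>y\<bar> powr p) / 2"
    by (simp add: field_simps)
  moreover have "\<bar>x + y\<bar> powr p \<le> (\<bar>x\<bar> + \<bar>y\<bar>) powr p" using p by (intro powr_mono2) auto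
  ultimately show ?thesis by (simp add: powr_divide powr_diff field_simps)
qed

text \<open>In the variables \<open>x\<close> and \<open>h = y - x\<close> both double integrals become integrals over \<open>h\<close> against the
  same function \<open>F\<close>. If \<open>x\<close> and \<open>x + 2h\<close> lie in the convex set \<open>P\<close>, then so does \<open>x + h\<close>; splitting
  the increment at this midpoint gives \<open>F(2h) \<le> 2\<^sup>p F(h)\<close>.\<close>

lemma fractional_poincare_convex:
  fixes P :: "'a::euclidean_space set" and u :: "'a \<Rightarrow> real"
  assumes u [measurable]: "u \<in> borel_measurable borel"
    and P [measurable]: "P \<in> sets borel" and P_convex: "convex P"
    and diam: "\<And>x y. x \<in> P \<Longrightarrow> y \<in> P \<Longrightarrow> norm (x - y) \<le> R"
    and p: "1 \<le> p" and d: "0 < \<delta>" "\<delta> < 1" and R: "0 < R"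
    and a: "a = real DIM('a) + p * \<delta>"
  shows "(\<integral>\<^sup>+x\<in>P. (\<integral>\<^sup>+y\<in>P. ennreal (\<bar>u x - u y\<bar> powr p) \<partial>lborel) \<partial>lborel)
    \<le> ennreal (p * (1 - \<delta>) * (2 * R) powr a) *
       (\<integral>\<^sup>+x\<in>P. (\<integral>\<^sup>+y\<in>P. ennreal (\<bar>u x - u y\<bar> powr p / norm (x - y) powr a) \<partial>lborel) \<partial>lborel)"
proof -
  define F where "F h = (\<integral>\<^sup>+x. ennreal (\<bar>u x - u (h + x)\<bar> powr p) * (indicator P x * indicator P (h + x)) \<partial>lborel)" for h
  have [measurable]: "F \<in> borel_measurable borel"
    unfolding F_def by measurable
  have polar: "(\<integral>\<^sup>+x\<in>P. (\<integral>\<^sup>+y\<in>P. ennreal (\<bar>u x - u y\<bar> powr p * k (y - x)) \<partial>lborel) \<partial>lborel)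
      = (\<integral>\<^sup>+h. F h * ennreal (k h) \<partial>lborel)"
    if [measurable]: "k \<in> borel_measurable borel" and k: "\<And>h. 0 \<le> k h" for k :: "'a \<Rightarrow> real"
  proof -
    have "(\<integral>\<^sup>+x\<in>P. (\<integral>\<^sup>+y\<in>P. ennreal (\<bar>u x - u y\<bar> powr p * k (y - x)) \<partial>lborel) \<partial>lborel)
        = (\<integral>\<^sup>+x. (\<integral>\<^sup>+y. ennreal (\<bar>u x - u y\<bar> powr p) * (indicator P x * indicator P y) * ennreal (k (y - x)) \<partial>lborel) \<partial>lborel)"
      using k by (subst nn_integral_multc[symmetric]) (auto simp: ennreal_mult mult_ac)
    also have "\<dots> = (\<integral>\<^sup>+x. (\<integral>\<^sup>+h. ennreal (\<bar>u x - u (h + x)\<bar> powr p) * (indicator P x * indicator P (h + x)) * ennreal (k h) \<partial>lborel) \<partial>lborel)"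
    proof (rule nn_integral_cong)
      fix x :: 'a
      show "(\<integral>\<^sup>+y. ennreal (\<bar>u x - u y\<bar> powr p) * (indicator P x * indicator P y) * ennreal (k (y - x)) \<partial>lborel)
        = (\<integral>\<^sup>+h. ennreal (\<bar>u x - u (h + x)\<bar> powr p) * (indicator P x * indicator P (h + x)) * ennreal (k h) \<partial>lborel)"
        by (subst nn_integral_lborel_translate[symmetric, of _ x]) (auto simp: add.commute)
    qed
    also have "\<dots> = (\<integral>\<^sup>+h. (\<integral>\<^sup>+x. ennreal (\<bar>u x - u (h + x)\<bar> powr p) * (indicator P x * indicator P (h + x)) * ennreal (k h) \<partial>lborel) \<partial>lborel)"
      by (rule lborel_pair.Fubini') measurable
    also have "\<dots> = (\<integral>\<^sup>+h. F h * ennreal (k h) \<partial>lborel)"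
      unfolding F_def by (subst nn_integral_multc) auto
    finally show ?thesis .
  qed
  have F0: "F 0 = 0" unfolding F_def by simp
  have F_supp: "F h = 0" if "norm h > R" for h
  proof -
    have "indicator P x * indicator P (h + x) = (0::ennreal)" for x
      using diam[of "h + x" x] that by (auto simp: indicator_def)
    then show ?thesis unfolding F_def by (simp only: mult_zero_right) simp
  qed
  have F_dbl: "F (2 *\<^sub>R h) \<le> ennreal (2 powr p) * F h" for h
  proof -
    have pt: "ennreal (\<bar>u x - u (2 *\<^sub>R h + x)\<bar> powr p) * (indicator P x * indicator P (2 *\<^sub>R h + x))
        \<le> ennreal (2 powr (p - 1)) * (ennreal (\<bar>u x - u (h + x)\<bar> powr p) * (indicator P x * indicator P (h + x))
          + ennreal (\<bar>u (h + x) - u (h + (h + x))\<bar> powr p) * (indicator P (h + x) * indicator P (h + (h + x))))" for x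
    proof (cases "x \<in> P \<and> 2 *\<^sub>R h + x \<in> P")
      case True
      then have "(1/2) *\<^sub>R x + (1/2) *\<^sub>R (2 *\<^sub>R h + x) \<in> P"
        using P_convex by (intro convexD) auto
      then have mid: "h + x \<in> P" by (simp add: algebra_simps flip: scaleR_left.add)
      have e: "2 *\<^sub>R h + x = h + (h + x)" by (simp add: scaleR_2)
      have "ennreal (\<bar>u x - u (h + (h + x))\<bar> powr p)
        \<le> ennreal (2 powr (p - 1) * (\<bar>u x - u (h + x)\<bar> powr p + \<bar>u (h + x) - u (h + (h + x))\<bar> powr p))"
        using abs_add_powr_le[OF p, of "u x - u (h + x)" "u (h + x) - u (h + (h + x))"] by (intro ennreal_leI) simp
      then show ?thesis using True mid unfolding e by (simp add: ennreal_mult ennreal_plus)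
    qed auto
    have "F (2 *\<^sub>R h) \<le> (\<integral>\<^sup>+x. ennreal (2 powr (p - 1)) * (ennreal (\<bar>u x - u (h + x)\<bar> powr p) * (indicator P x * indicator P (h + x))
          + ennreal (\<bar>u (h + x) - u (h + (h + x))\<bar> powr p) * (indicator P (h + x) * indicator P (h + (h + x)))) \<partial>lborel)"
      unfolding F_def by (intro nn_integral_mono pt)
    also have "\<dots> = ennreal (2 powr (p - 1)) * (F h
        + (\<integral>\<^sup>+x. ennreal (\<bar>u (h + x) - u (h + (h + x))\<bar> powr p) * (indicator P (h + x) * indicator P (h + (h + x))) \<partial>lborel))"
      unfolding F_def by (subst nn_integral_cmult, simp, subst nn_integral_add) simp_all
    also have "(\<integral>\<^sup>+x. ennreal (\<bar>u (h + x) - u (h + (h + x))\<bar> powr p) * (indicator P (h + x) * indicator P (h + (h + x))) \<partial>lborel) = F h"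
      unfolding F_def by (rule nn_integral_lborel_translate) measurable
    also have "ennreal (2 powr (p - 1)) * (F h + F h) = ennreal (2 powr (p - 1)) * (ennreal 2 * F h)"
      by (simp add: mult_2[symmetric])
    also have "\<dots> = ennreal (2 powr p) * F h"
      by (simp add: mult.assoc[symmetric] ennreal_mult[symmetric] powr_diff del: ennreal_numeral)
    finally show ?thesis .
  qed
  have "(\<integral>\<^sup>+x\<in>P. (\<integral>\<^sup>+y\<in>P. ennreal (\<bar>u x - u y\<bar> powr p) \<partial>lborel) \<partial>lborel) = (\<integral>\<^sup>+h. F h \<partial>lborel)"
    using polar[of "\<lambda>_. 1"] by simp
  also have "\<dots> \<le> ennreal (p * (1 - \<delta>) * (2 * R) powr a) * (\<integral>\<^sup>+h. F h * ennreal (1 / norm h powr a) \<partial>lborel)"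
    by (rule fractional_scaling_gain[OF _ F0 F_dbl F_supp p d R a]) simp_all
  also have "(\<integral>\<^sup>+h. F h * ennreal (1 / norm h powr a) \<partial>lborel)
     = (\<integral>\<^sup>+x\<in>P. (\<integral>\<^sup>+y\<in>P. ennreal (\<bar>u x - u y\<bar> powr p / norm (x - y) powr a) \<partial>lborel) \<partial>lborel)"
    by (subst polar[symmetric]) (simp_all add: norm_minus_commute)
  finally show ?thesis .
qed

section \<open>Dyadic cells of a cube\<close>

text \<open>The cell of generation \<open>k\<close> that contains \<open>x\<close>, in the dyadic grid with origin \<open>a\<close> and coarsest
  side \<open>l\<close>. Sharing a cell means having the same rounded coordinates, so cells of one generation
  partition the whole space, and measurability in both \<open>x\<close> and \<open>y\<close> is immediate.\<close>

definition cell :: "real ^ 'n \<Rightarrow> real \<Rightarrow> nat \<Rightarrow> real ^ 'n \<Rightarrow> (real ^ 'n) set" where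
  "cell a l k x = {y. \<forall>i. \<lfloor>(y $ i - a $ i) * 2 ^ k / l\<rfloor> = \<lfloor>(x $ i - a $ i) * 2 ^ k / l\<rfloor>}"

lemma in_cell_self [simp]: "x \<in> cell a l k x"
  by (simp add: cell_def)

lemma in_cell_commute: "y \<in> cell a l k x \<longleftrightarrow> x \<in> cell a l k y"
  by (auto simp: cell_def)

lemma cell_eqI: "y \<in> cell a l k x \<Longrightarrow> cell a l k y = cell a l k x"
  by (simp add: cell_def)

lemma floor_double_cong:
  fixes s t :: real
  assumes "\<lfloor>2 * s\<rfloor> = \<lfloor>2 * t\<rfloor>"
  shows "\<lfloor>s\<rfloor> = \<lfloor>t\<rfloor>"
proof -
  have "\<lfloor>s\<rfloor> = \<lfloor>2 * s\<rfloor> div 2" for s :: real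
    using floor_divide_real_eq_div[of 2 "2 * s"] by simp
  then show ?thesis using assms by metis
qed

lemma cell_Suc_subset: "cell a l (Suc k) x \<subseteq> cell a l k x"
proof -
  have e: "t * 2 ^ Suc k / l = 2 * (t * 2 ^ k / l)" for t :: real by simp
  show ?thesis
    unfolding cell_def e by (auto intro: floor_double_cong)
qed

lemma cell_antimono: "j \<le> k \<Longrightarrow> cell a l k x \<subseteq> cell a l j x"
  by (rule lift_Suc_antimono_le[of "\<lambda>k. cell a l k x"]) (rule cell_Suc_subset)

lemma cell_eq_half_open:
  fixes x a :: "real ^ 'n" and k :: nat and l :: real
  assumes l: "0 < l"
  defines "b \<equiv> (\<chi> i. a $ i + real_of_int \<lfloor>(x $ i - a $ i) * 2 ^ k / l\<rfloor> * (l / 2 ^ k))"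
  shows "cell a l k x = {y. \<forall>i. b $ i \<le> y $ i \<and> y $ i < b $ i + l / 2 ^ k}"
proof -
  have "\<lfloor>(y $ i - a $ i) * 2 ^ k / l\<rfloor> = \<lfloor>(x $ i - a $ i) * 2 ^ k / l\<rfloor>
     \<longleftrightarrow> b $ i \<le> y $ i \<and> y $ i < b $ i + l / 2 ^ k" for y :: "real ^ 'n" and i
    unfolding b_def using l by (auto simp: floor_eq_iff field_simps)
  then show ?thesis unfolding cell_def by blast
qed

lemma is_cube_cell:
  fixes x a :: "real ^ 'n"
  assumes l: "0 < l"
  shows "is_cube (l / 2 ^ k) (cell a l k x)"
proof -
  define b :: "real ^ 'n" where "b = (\<chi> i. a $ i + real_of_int \<lfloor>(x $ i - a $ i) * 2 ^ k / l\<rfloor> * (l / 2 ^ k))"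
  have "cell a l k x = {y. \<forall>i. y $ i \<in> {b $ i ..< b $ i + l / 2 ^ k}}"
    using cell_eq_half_open[OF l, of a k x] unfolding b_def by simp
  moreover have "\<forall>i. {b $ i <..< b $ i + l / 2 ^ k} \<subseteq> {b $ i ..< b $ i + l / 2 ^ k}
     \<and> {b $ i ..< b $ i + l / 2 ^ k} \<subseteq> {b $ i .. b $ i + l / 2 ^ k}"
    by auto
  ultimately show ?thesis unfolding is_cube_def using l
    by (intro conjI exI[of _ b] exI[of _ "\<lambda>i. {b $ i ..< b $ i + l / 2 ^ k}"]) auto
qed

lemma convex_cell:
  assumes "0 < l"
  shows "convex (cell a l k x)"
proof -
  have "convex {y :: real ^ 'n. \<forall>i. b $ i \<le> y $ i \<and> y $ i < b $ i + s}" for b :: "real ^ 'n" and s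
  proof -
    have "{y :: real ^ 'n. \<forall>i. b $ i \<le> y $ i \<and> y $ i < b $ i + s} =
        (\<Inter>i. {y. axis i 1 \<bullet> y \<ge> b $ i} \<inter> {y. axis i 1 \<bullet> y < b $ i + s})"
      by (auto simp: inner_axis inner_commute)
    also have "convex \<dots>"
      by (intro convex_INT convex_Int ballI convex_halfspace_ge convex_halfspace_lt)
    finally show ?thesis .
  qed
  then show ?thesis unfolding cell_eq_half_open[OF assms] .
qed

lemma cell_diameter:
  fixes x a :: "real ^ 'n"
  assumes l: "0 < l" and "y \<in> cell a l k x" "z \<in> cell a l k x"
  shows "norm (y - z) \<le> real CARD('n) * (l / 2 ^ k)"
proof -
  have "norm (y - z) \<le> (\<Sum>i\<in>UNIV. \<bar>(y - z) $ i\<bar>)" by (rule norm_le_l1_cart)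
  also have "\<dots> \<le> (\<Sum>i\<in>(UNIV :: 'n set). l / 2 ^ k)"
  proof (rule sum_mono)
    fix i
    show "\<bar>(y - z) $ i\<bar> \<le> l / 2 ^ k"
      using assms(2,3)[unfolded cell_eq_half_open[OF l]] by (auto simp: abs_le_iff dest!: spec[of _ i])
  qed
  finally show ?thesis by simp
qed

lemma measurable_cell_index [measurable]:
  "(\<lambda>x :: real ^ 'n. \<lfloor>(x $ i - c) * 2 ^ k / l\<rfloor>) \<in> borel \<rightarrow>\<^sub>M count_space UNIV"
proof (rule measurable_compose[OF _ measurable_real_floor])
  have [measurable]: "(\<lambda>x :: real ^ 'n. x $ i) \<in> borel_measurable borel"
    by (intro borel_measurable_continuous_onI continuous_intros)
  show "(\<lambda>x :: real ^ 'n. (x $ i - c) * 2 ^ k / l) \<in> borel_measurable borel"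
    by simp
qed

lemma pred_in_cell [measurable (raw)]:
  fixes f g :: "'b \<Rightarrow> real ^ 'n"
  assumes f: "f \<in> borel_measurable M" and g: "g \<in> borel_measurable M"
  shows "Measurable.pred M (\<lambda>z. g z \<in> cell a l k (f z))"
proof -
  have "Measurable.pred M (\<lambda>z. \<lfloor>(g z $ i - a $ i) * 2 ^ k / l\<rfloor> = \<lfloor>(f z $ i - a $ i) * 2 ^ k / l\<rfloor>)" for i
  proof -
    have [measurable]: "(\<lambda>z. \<lfloor>(f z $ i - a $ i) * 2 ^ k / l\<rfloor>) \<in> M \<rightarrow>\<^sub>M count_space UNIV"
      "(\<lambda>z. \<lfloor>(g z $ i - a $ i) * 2 ^ k / l\<rfloor>) \<in> M \<rightarrow>\<^sub>M count_space UNIV"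
      by (rule measurable_compose[OF f measurable_cell_index] measurable_compose[OF g measurable_cell_index])+
    show ?thesis by measurable
  qed
  then have "Measurable.pred M (\<lambda>z. \<forall>i\<in>UNIV. \<lfloor>(g z $ i - a $ i) * 2 ^ k / l\<rfloor> = \<lfloor>(f z $ i - a $ i) * 2 ^ k / l\<rfloor>)"
    by (intro pred_intros_finite) auto
  then show ?thesis by (simp only: cell_def mem_Collect_eq ball_UNIV)
qed

lemma sets_cell [measurable]: "cell a l k x \<in> sets borel"
proof -
  have "Measurable.pred borel (\<lambda>y. y \<in> cell a l k x)"
    by (rule pred_in_cell) (rule borel_measurable_const, rule measurable_ident_sets, rule refl)
  then show ?thesis by (simp only: pred_def space_borel UNIV_I simp_thms Collect_mem_eq)
qed

lemma
  fixes b :: "real ^ 'n"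
  assumes s: "0 < s"
  shows null_cube_boundary: "cbox b (b + (\<chi> i. s)) - box b (b + (\<chi> i. s)) \<in> null_sets lborel"
    and emeasure_cube_box: "emeasure lborel (box b (b + (\<chi> i. s))) = ennreal (s ^ CARD('n))"
    and emeasure_cube_cbox: "emeasure lborel (cbox b (b + (\<chi> i. s))) = ennreal (s ^ CARD('n))"
proof -
  have pr: "(\<Prod>c\<in>Basis. (\<chi> i :: 'n. s) \<bullet> c) = s ^ CARD('n)"
  proof -
    have "(\<Prod>c\<in>Basis. (\<chi> i :: 'n. s) \<bullet> c) = (\<Prod>c\<in>(Basis :: (real ^ 'n) set). s)"
      by (rule prod.cong) (auto simp: Basis_vec_def inner_axis)
    then show ?thesis by simp
  qed
  have le: "\<forall>c\<in>Basis. b \<bullet> c \<le> (b + (\<chi> i. s)) \<bullet> c"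
    using s by (auto simp: Basis_vec_def inner_axis)
  show c: "emeasure lborel (cbox b (b + (\<chi> i. s))) = ennreal (s ^ CARD('n))"
    using le by (simp add: emeasure_lborel_cbox_eq pr)
  show o: "emeasure lborel (box b (b + (\<chi> i. s))) = ennreal (s ^ CARD('n))"
    using le by (simp add: emeasure_lborel_box_eq pr)
  show "cbox b (b + (\<chi> i. s)) - box b (b + (\<chi> i. s)) \<in> null_sets lborel"
    using c o s by (intro null_setsI) (auto simp: emeasure_Diff box_subset_cbox)
qed

lemma emeasure_cube_between:
  fixes b :: "real ^ 'n"
  assumes s: "0 < s" and Q: "box b (b + (\<chi> i. s)) \<subseteq> Q" "Q \<subseteq> cbox b (b + (\<chi> i. s))"
    and [measurable]: "Q \<in> sets borel"
  shows "emeasure lborel Q = ennreal (s ^ CARD('n))"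
proof (rule antisym)
  show "emeasure lborel Q \<le> ennreal (s ^ CARD('n))"
    unfolding emeasure_cube_cbox[OF s, of b, symmetric] by (intro emeasure_mono Q) simp
  show "ennreal (s ^ CARD('n)) \<le> emeasure lborel Q"
    unfolding emeasure_cube_box[OF s, of b, symmetric] by (intro emeasure_mono Q) (simp add: assms)
qed

lemma emeasure_cell:
  fixes x a :: "real ^ 'n"
  assumes l: "0 < l"
  shows "emeasure lborel (cell a l k x) = ennreal ((l / 2 ^ k) ^ CARD('n))"
proof (rule emeasure_cube_between)
  define b :: "real ^ 'n" where "b = (\<chi> i. a $ i + real_of_int \<lfloor>(x $ i - a $ i) * 2 ^ k / l\<rfloor> * (l / 2 ^ k))"
  have c: "cell a l k x = {y. \<forall>i. b $ i \<le> y $ i \<and> y $ i < b $ i + l / 2 ^ k}"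
    unfolding b_def by (rule cell_eq_half_open[OF l])
  show "box b (b + (\<chi> i. l / 2 ^ k)) \<subseteq> cell a l k x"
    unfolding c by (auto simp: mem_box_cart less_imp_le)
  show "cell a l k x \<subseteq> cbox b (b + (\<chi> i. l / 2 ^ k))"
    unfolding c by (auto simp: mem_box_cart less_imp_le)
  show "0 < l / 2 ^ k" using l by simp
  show "cell a l k x \<in> sets borel" by (rule sets_cell)
qed

text \<open>A cell is determined by its generation and an integer vector. There are thus only countably
  many cells, and exceptional null sets chosen for each of them can be united.\<close>

lemma AE_all_cells:
  fixes a :: "real ^ 'n" and R :: "(real ^ 'n) set \<Rightarrow> real ^ 'n \<Rightarrow> bool"
  assumes "\<And>k x. AE y in lborel. y \<in> cell a l k x \<longrightarrow> R (cell a l k x) y"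
  shows "AE y in lborel. \<forall>k. R (cell a l k y) y"
proof -
  define idx where "idx k y = (\<chi> i. \<lfloor>(y $ i - a $ i) * 2 ^ k / l\<rfloor>)" for k and y :: "real ^ 'n"
  define rep where "rep k m = (SOME x. idx k x = m)" for k m
  have rep: "cell a l k (rep k (idx k y)) = cell a l k y" for k y
  proof -
    have "idx k (rep k (idx k y)) = idx k y"
      unfolding rep_def by (rule someI[of "\<lambda>x. idx k x = idx k y" y]) simp
    then show ?thesis unfolding idx_def cell_def by (simp add: vec_eq_iff)
  qed
  have "AE y in lborel. \<forall>k m. y \<in> cell a l k (rep k m) \<longrightarrow> R (cell a l k (rep k m)) y"
    unfolding AE_all_countable using assms by blast
  then show ?thesis
  proof eventually_elim
    case (elim y)
    show ?case
    proof
      fix k show "R (cell a l k y) y"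
        using elim[rule_format, of k "idx k y"] unfolding rep by simp
    qed
  qed
qed

section \<open>Means and mean oscillation\<close>

definition mean :: "'a::euclidean_space set \<Rightarrow> ('a \<Rightarrow> real) \<Rightarrow> real" where
  "mean P v = (LINT y:P|lborel. v y) / measure lborel P"

lemma dist_mean_le:
  fixes v :: "'a::euclidean_space \<Rightarrow> real"
  assumes v: "set_integrable lborel P v" and [measurable]: "P \<in> sets borel"
    and m: "emeasure lborel P = ennreal m" "0 < m"
  shows "ennreal m * ennreal \<bar>c - mean P v\<bar> \<le> (\<integral>\<^sup>+y\<in>P. ennreal \<bar>c - v y\<bar> \<partial>lborel)"
proof -
  have P: "measure lborel P = m" using m by (simp add: measure_def)
  have c: "set_integrable lborel P (\<lambda>_. c)"
    unfolding set_integrable_def using m by (intro integrable_scaleR_left integrable_real_indicator) auto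
  have cv: "set_integrable lborel P (\<lambda>y. c - v y)" by (intro set_integral_diff c v)
  have "(LINT y:P|lborel. c - v y) = m * c - (LINT y:P|lborel. v y)"
    by (subst set_integral_diff(2)[OF c v]) (use P m in \<open>auto simp: set_lebesgue_integral_def\<close>)
  also have "\<dots> = m * (c - mean P v)"
    using m by (simp add: mean_def P field_simps)
  finally have e: "m * \<bar>c - mean P v\<bar> = \<bar>LINT y:P|lborel. c - v y\<bar>"
    using m by (simp add: abs_mult)
  have "\<bar>LINT y:P|lborel. c - v y\<bar> \<le> (LINT y|lborel. norm (indicator P y *\<^sub>R (c - v y)))"
    unfolding set_lebesgue_integral_def using integral_norm_bound[of lborel "\<lambda>y. indicator P y *\<^sub>R (c - v y)"] by simp
  then have "ennreal (m * \<bar>c - mean P v\<bar>) \<le> ennreal (LINT y|lborel. norm (indicator P y *\<^sub>R (c - v y)))"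
    unfolding e by (rule ennreal_leI)
  also have "\<dots> = (\<integral>\<^sup>+y. ennreal (norm (indicator P y *\<^sub>R (c - v y))) \<partial>lborel)"
    using cv unfolding set_integrable_def by (subst nn_integral_eq_integral) auto
  also have "\<dots> = (\<integral>\<^sup>+y\<in>P. ennreal \<bar>c - v y\<bar> \<partial>lborel)"
    by (intro nn_integral_cong) (auto simp: indicator_def)
  finally show ?thesis using m by (simp add: ennreal_mult)
qed

text \<open>A substitute for Jensen's inequality: integrated against a measure for which the mean of \<open>z\<^sup>p\<close> is
  at most \<open>L\<^sup>p\<close>, it bounds the mean of \<open>z\<close> by \<open>2 L\<close>.\<close>

lemma ennreal_le_add_powr:
  assumes L: "0 < L" and z: "0 \<le> z" and p: "1 \<le> p"
  shows "ennreal z \<le> ennreal L + ennreal (L powr (1 - p)) * ennreal (z powr p)"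
proof -
  have "z \<le> L + L powr (1 - p) * z powr p"
  proof (cases "z \<le> L")
    case True then show ?thesis by (simp add: add_increasing2)
  next
    case False
    then have "z = z powr (1 - p) * z powr p" using L by (simp flip: powr_add)
    also have "\<dots> \<le> L powr (1 - p) * z powr p"
      using False L p by (intro mult_right_mono powr_mono2') auto
    finally show ?thesis using L by simp
  qed
  then have "ennreal z \<le> ennreal (L + L powr (1 - p) * z powr p)" by (rule ennreal_leI)
  then show ?thesis using L by (simp add: ennreal_mult)
qed

lemma nn_integral_le_of_powr:
  fixes f :: "'a \<Rightarrow> real"
  assumes [measurable]: "f \<in> borel_measurable M" and f: "\<And>x. 0 \<le> f x"
    and [measurable]: "P \<in> sets M" and m: "emeasure M P = ennreal m" "0 \<le> m"
    and L: "0 < L" and p: "1 \<le> p"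
    and le: "(\<integral>\<^sup>+x\<in>P. ennreal (f x powr p) \<partial>M) \<le> ennreal (L powr p * m)"
  shows "(\<integral>\<^sup>+x\<in>P. ennreal (f x) \<partial>M) \<le> ennreal (2 * L * m)"
proof -
  have "(\<integral>\<^sup>+x\<in>P. ennreal (f x) \<partial>M)
      \<le> (\<integral>\<^sup>+x. ennreal L * indicator P x + ennreal (L powr (1 - p)) * (ennreal (f x powr p) * indicator P x) \<partial>M)"
    using ennreal_le_add_powr[OF L f p] by (intro nn_integral_mono) (auto simp: indicator_def)
  also have "\<dots> = ennreal L * ennreal m + ennreal (L powr (1 - p)) * (\<integral>\<^sup>+x\<in>P. ennreal (f x powr p) \<partial>M)"
    by (subst nn_integral_add) (auto simp: nn_integral_cmult nn_integral_cmult_indicator m)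
  also have "\<dots> \<le> ennreal L * ennreal m + ennreal (L powr (1 - p)) * ennreal (L powr p * m)"
    using le by (intro add_left_mono mult_left_mono) auto
  also have "\<dots> = ennreal (L * m + L powr (1 - p) * (L powr p * m))"
    using L m by (simp add: ennreal_mult ennreal_plus)
  also have "L powr (1 - p) * (L powr p * m) = L * m"
    using L by (simp add: powr_add[symmetric] flip: mult.assoc)
  finally show ?thesis by (simp add: algebra_simps)
qed

lemma dist_mean_le_powr:
  fixes v :: "'a::euclidean_space \<Rightarrow> real"
  assumes v: "set_integrable lborel P v" and [measurable]: "v \<in> borel_measurable borel" "P \<in> sets borel"
    and m: "emeasure lborel P = ennreal m" "0 < m" and L: "0 < L" and p: "1 \<le> p"
    and le: "(\<integral>\<^sup>+y\<in>P. ennreal (\<bar>c - v y\<bar> powr p) \<partial>lborel) \<le> ennreal (L powr p * m)"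
  shows "\<bar>c - mean P v\<bar> \<le> 2 * L"
proof -
  have "ennreal (m * \<bar>c - mean P v\<bar>) \<le> (\<integral>\<^sup>+y\<in>P. ennreal \<bar>c - v y\<bar> \<partial>lborel)"
    using dist_mean_le[OF v _ m] m by (simp add: ennreal_mult)
  also have "\<dots> \<le> ennreal (2 * L * m)"
    using nn_integral_le_of_powr[of "\<lambda>y. \<bar>c - v y\<bar>" lborel P m L p] m L p le by simp
  finally have "m * \<bar>c - mean P v\<bar> \<le> 2 * L * m" using L m by (subst (asm) ennreal_le_iff) auto
  then show ?thesis using m by (simp add: mult.commute)
qed

lemma mean_subset_diff_le_powr:
  fixes v :: "'a::euclidean_space \<Rightarrow> real"
  assumes v: "set_integrable lborel P v" and [measurable]: "v \<in> borel_measurable borel" "P \<in> sets borel" "P' \<in> sets borel"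
    and sub: "P' \<subseteq> P"
    and m: "emeasure lborel P = ennreal m" "0 < m" and m': "emeasure lborel P' = ennreal m'" "0 < m'"
    and L: "0 < L" and p: "1 \<le> p"
    and le: "(\<integral>\<^sup>+x\<in>P. (\<integral>\<^sup>+y\<in>P. ennreal (\<bar>v x - v y\<bar> powr p) \<partial>lborel) \<partial>lborel) \<le> ennreal (L powr p * (m * m))"
  shows "\<bar>mean P v - mean P' v\<bar> \<le> 2 * L * (m / m')"
proof -
  have v': "set_integrable lborel P' v" by (rule set_integrable_subset[OF v]) (use sub in auto)
  have "ennreal m' * (ennreal m * ennreal \<bar>mean P' v - mean P v\<bar>)
      \<le> ennreal m' * (\<integral>\<^sup>+x\<in>P. ennreal \<bar>mean P' v - v x\<bar> \<partial>lborel)"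
    by (intro mult_left_mono dist_mean_le[OF v _ m]) auto
  also have "\<dots> = (\<integral>\<^sup>+x\<in>P. ennreal m' * ennreal \<bar>v x - mean P' v\<bar> \<partial>lborel)"
    by (subst nn_integral_cmult[symmetric]) (auto simp: mult_ac abs_minus_commute)
  also have "\<dots> \<le> (\<integral>\<^sup>+x\<in>P. (\<integral>\<^sup>+y\<in>P'. ennreal \<bar>v x - v y\<bar> \<partial>lborel) \<partial>lborel)"
    by (intro nn_integral_mono mult_right_mono dist_mean_le[OF v' _ m']) auto
  also have "\<dots> \<le> (\<integral>\<^sup>+x\<in>P. (\<integral>\<^sup>+y\<in>P. ennreal \<bar>v x - v y\<bar> \<partial>lborel) \<partial>lborel)"
    using sub by (intro nn_integral_mono mult_right_mono mult_left_mono) (auto simp: indicator_def)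
  also have "\<dots> \<le> (\<integral>\<^sup>+x. ennreal (L * m) * indicator P x + ennreal (L powr (1 - p)) *
      ((\<integral>\<^sup>+y\<in>P. ennreal (\<bar>v x - v y\<bar> powr p) \<partial>lborel) * indicator P x) \<partial>lborel)"
  proof (intro nn_integral_mono)
    fix x
    have "(\<integral>\<^sup>+y\<in>P. ennreal \<bar>v x - v y\<bar> \<partial>lborel)
      \<le> (\<integral>\<^sup>+y. ennreal L * indicator P y + ennreal (L powr (1 - p)) * (ennreal (\<bar>v x - v y\<bar> powr p) * indicator P y) \<partial>lborel)"
      using ennreal_le_add_powr[OF L _ p] by (intro nn_integral_mono) (auto simp: indicator_def)
    also have "\<dots> = ennreal L * ennreal m + ennreal (L powr (1 - p)) * (\<integral>\<^sup>+y\<in>P. ennreal (\<bar>v x - v y\<bar> powr p) \<partial>lborel)"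
      by (subst nn_integral_add) (auto simp: nn_integral_cmult nn_integral_cmult_indicator m)
    finally show "(\<integral>\<^sup>+y\<in>P. ennreal \<bar>v x - v y\<bar> \<partial>lborel) * indicator P x
      \<le> ennreal (L * m) * indicator P x + ennreal (L powr (1 - p)) *
      ((\<integral>\<^sup>+y\<in>P. ennreal (\<bar>v x - v y\<bar> powr p) \<partial>lborel) * indicator P x)"
      using L m by (auto simp: indicator_def ennreal_mult)
  qed
  also have "\<dots> = ennreal (L * m) * ennreal m + ennreal (L powr (1 - p)) *
      (\<integral>\<^sup>+x\<in>P. (\<integral>\<^sup>+y\<in>P. ennreal (\<bar>v x - v y\<bar> powr p) \<partial>lborel) \<partial>lborel)"
    by (subst nn_integral_add) (auto simp: nn_integral_cmult nn_integral_cmult_indicator m)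
  also have "\<dots> \<le> ennreal (L * m) * ennreal m + ennreal (L powr (1 - p)) * ennreal (L powr p * (m * m))"
    using le by (intro add_left_mono mult_left_mono) auto
  also have "\<dots> = ennreal (L * m * m + L powr (1 - p) * (L powr p * (m * m)))"
    using L m by (simp add: ennreal_mult ennreal_plus)
  also have "L powr (1 - p) * (L powr p * (m * m)) = L * m * m"
    using L by (simp add: powr_add[symmetric] flip: mult.assoc)
  finally have "m' * (m * \<bar>mean P' v - mean P v\<bar>) \<le> L * m * m + L * m * m"
    using L m m' by (simp add: ennreal_mult[symmetric])
  then have "m * (m' * \<bar>mean P v - mean P' v\<bar>) \<le> m * (2 * L * m)"
    by (simp add: algebra_simps abs_minus_commute)
  then have "m' * \<bar>mean P v - mean P' v\<bar> \<le> 2 * L * m"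
    using m by (simp only: mult_le_cancel_left_pos)
  then have "\<bar>mean P v - mean P' v\<bar> \<le> 2 * L * m / m'"
    by (subst pos_le_divide_eq[OF m'(2)]) (simp only: mult.commute)
  then show ?thesis by simp
qed

section \<open>Pointwise control of the oscillation by a chain of means\<close>

lemma powr_self_inverse_le_2:
  fixes p :: real
  assumes p: "1 \<le> p"
  shows "p powr (1 / p) \<le> 2"
proof -
  have "ln (p / 2) \<le> p / 2 - 1" using p by (intro ln_le_minus_one) auto
  then have "ln p \<le> p / 2 - 1 + ln 2" using p by (simp add: ln_div)
  also have "\<dots> \<le> p * ln 2"
  proof -
    have "p * (1/2) \<le> p * ln 2" using p ln2_ge_two_thirds by (intro mult_left_mono) auto
    then show ?thesis using ln_2_less_1 by simp
  qed
  finally have "ln p / p \<le> ln 2" using p by (simp add: field_simps)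
  then have "exp (ln p / p) \<le> 2" by (metis exp_le_cancel_iff exp_ln zero_less_numeral)
  then show ?thesis using p by (simp add: powr_def)
qed

locale fractional_cube =
  fixes n :: real and a :: "real ^ 'n" and l \<delta> p :: real and u :: "real ^ 'n \<Rightarrow> real"
  assumes l: "0 < l" and p: "1 \<le> p" and d: "0 < \<delta>" "\<delta> < 1"
    and n: "n = real CARD('n)" and subcritical: "p * \<delta> < n"
    and u_borel [measurable]: "u \<in> borel_measurable borel"
    and u_integrable: "set_integrable lborel (cell a l 0 a) u"
begin

abbreviation Q :: "(real ^ 'n) set" where "Q \<equiv> cell a l 0 a"
abbreviation side :: "nat \<Rightarrow> real" where "side k \<equiv> l / 2 ^ k"
abbreviation C :: "nat \<Rightarrow> real ^ 'n \<Rightarrow> (real ^ 'n) set" where "C k x \<equiv> cell a l k x"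

definition g :: "real ^ 'n \<Rightarrow> ennreal" where
  "g x = (\<integral>\<^sup>+y\<in>Q. ennreal (\<bar>u x - u y\<bar> powr p / norm (x - y) powr (n + p * \<delta>)) \<partial>lborel)"

text \<open>In terms of \<open>s\<close> the Sobolev exponent \<open>p\<^sup>*\<close> with \<open>1/p - 1/p\<^sup>* = \<delta>/n\<close> is \<open>n / s\<close>. Besides, \<open>2\<^sup>s\<close> is
  the rate at which the bound on the increments of the means grows from one generation of cells
  to the next.\<close>

definition s :: real where "s = n / p - \<delta>"

text \<open>The dimensional constant in the comparison of means over consecutive cells: it collects the ratio
  \<open>2\<^sup>n\<close> of the measures of the two cells, and a bound for the \<open>p\<close>-th root of
  \<open>(2n)\<^bsup>n + p \<delta>\<^esup>\<close>, which comes from replacing \<open>|x - y|\<close> by the diameter of a cell.\<close>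

definition D :: real where "D = 2 powr (n + 2) * (2 * n) powr (n + 1)"

lemma n1: "1 \<le> n" by (simp add: n Suc_leI)

lemma s_pos: "0 < s" using subcritical p by (simp add: s_def field_simps)

lemma D1: "1 \<le> D"
  unfolding D_def using n1 by (intro mult_ge1_I ge_one_powr_ge_zero) auto

lemma side_pos: "0 < side k" using l by simp

lemma g_borel [measurable]: "g \<in> borel_measurable borel"
  unfolding g_def by measurable

lemma cell_sub_Q: "x \<in> Q \<Longrightarrow> C k x \<subseteq> Q"
  using cell_antimono[of 0 k a l x] cell_eqI[of x a l 0 a] by simp

lemma cell_measure: "emeasure lborel (C k x) = ennreal (side k ^ CARD('n))"
  by (rule emeasure_cell[OF l])

lemma side_pow: "side k ^ CARD('n) = side k powr n"
  using side_pos[of k] by (simp add: n powr_realpow)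

lemma powr_n_bound:
  assumes c: "1 \<le> c"
  shows "(c powr (n + p * \<delta>)) powr (1 / p) \<le> c powr (n + 1)"
proof -
  have "n / p \<le> n" using n1 p by (simp add: field_simps)
  then have "(n + p * \<delta>) * (1 / p) \<le> n + 1" using p d by (simp add: add_divide_distrib)
  then show ?thesis using c unfolding powr_powr by (intro powr_mono) auto
qed

text \<open>The unweighted Poincare inequality on the larger cell, whose diameter is at most \<open>n\<close> times its
  side, followed by restriction of the mean oscillation to the smaller cell. The factors \<open>p\<^bsup>1/p\<^esup>\<close>
  and \<open>((2n)\<^bsup>n + p \<delta>\<^esup>)\<^bsup>1/p\<^esup>\<close> stay bounded in terms of \<open>n\<close>.\<close>

lemma mean_step:
  assumes x: "x \<in> Q" and M: "0 < M"
    and le: "(\<integral>\<^sup>+y\<in>C k x. g y \<partial>lborel) \<le> ennreal (M * side k powr n)"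
  shows "\<bar>mean (C k x) u - mean (C (Suc k) x) u\<bar> \<le> D * (1 - \<delta>) powr (1 / p) * side k powr \<delta> * M powr (1 / p)"
proof -
  define r where "r = side k"
  have r: "0 < r" using side_pos by (simp add: r_def)
  define e where "e = n + p * \<delta>"
  define H where "H = p * (1 - \<delta>) * (2 * n) powr e * M"
  define L where "L = H powr (1 / p) * r powr \<delta>"
  have H: "0 < H" unfolding H_def using p d n1 M by simp
  have L: "0 < L" unfolding L_def using H r by simp
  have L_powr: "L powr p = H * r powr (p * \<delta>)"
    unfolding L_def using H r p by (simp add: powr_mult powr_powr mult.commute)
  have energy: "(\<integral>\<^sup>+z\<in>C k x. (\<integral>\<^sup>+y\<in>C k x. ennreal (\<bar>u z - u y\<bar> powr p / norm (z - y) powr e) \<partial>lborel) \<partial>lborel)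
     \<le> (\<integral>\<^sup>+y\<in>C k x. g y \<partial>lborel)"
    unfolding g_def e_def using cell_sub_Q[OF x, of k]
    by (intro nn_integral_mono mult_right_mono mult_left_mono) (auto simp: indicator_def)
  have "(\<integral>\<^sup>+z\<in>C k x. (\<integral>\<^sup>+y\<in>C k x. ennreal (\<bar>u z - u y\<bar> powr p) \<partial>lborel) \<partial>lborel)
     \<le> ennreal (p * (1 - \<delta>) * (2 * (n * r)) powr e) *
     (\<integral>\<^sup>+z\<in>C k x. (\<integral>\<^sup>+y\<in>C k x. ennreal (\<bar>u z - u y\<bar> powr p / norm (z - y) powr e) \<partial>lborel) \<partial>lborel)"
    using n1 r l cell_diameter[OF l] p d
    by (intro fractional_poincare_convex convex_cell sets_cell u_borel) (auto simp: e_def r_def n)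
  also have "\<dots> \<le> ennreal (p * (1 - \<delta>) * (2 * (n * r)) powr e) * ennreal (M * r powr n)"
    using energy le unfolding r_def by (intro mult_left_mono) (auto intro: order_trans)
  also have "\<dots> = ennreal (L powr p * (r ^ CARD('n) * r ^ CARD('n)))"
  proof -
    have "(2 * (n * r)) powr e = (2 * n) powr e * (r powr n * r powr (p * \<delta>))"
      using n1 r by (simp add: powr_mult powr_add e_def)
    then have "p * (1 - \<delta>) * (2 * (n * r)) powr e * (M * r powr n) = L powr p * (r ^ CARD('n) * r ^ CARD('n))"
      unfolding L_powr H_def r_def side_pow by (simp add: mult_ac)
    then show ?thesis using p d M r by (subst ennreal_mult[symmetric]) auto
  qed
  finally have "\<bar>mean (C k x) u - mean (C (Suc k) x) u\<bar> \<le> 2 * L * (side k ^ CARD('n) / side (Suc k) ^ CARD('n))"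
    using L p l side_pos
    by (intro mean_subset_diff_le_powr[where p=p] set_integrable_subset[OF u_integrable] cell_sub_Q x
        cell_Suc_subset cell_measure u_borel sets_cell)
       (auto simp: r_def sets_cell cell_measure)
  also have "side k ^ CARD('n) / side (Suc k) ^ CARD('n) = 2 powr n"
    using l by (simp add: n powr_realpow power_divide power_mult_distrib)
  also have "2 * L * 2 powr n \<le> D * (1 - \<delta>) powr (1 / p) * r powr \<delta> * M powr (1 / p)"
  proof -
    have "H powr (1 / p) = p powr (1 / p) * (1 - \<delta>) powr (1 / p) * ((2 * n) powr e) powr (1 / p) * M powr (1 / p)"
      unfolding H_def using p d M n1 by (simp add: powr_mult)
    also have "\<dots> \<le> 2 * (1 - \<delta>) powr (1 / p) * (2 * n) powr (n + 1) * M powr (1 / p)"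
      using powr_n_bound[of "2 * n"] n1 powr_self_inverse_le_2[OF p]
      by (intro mult_right_mono mult_mono) (auto simp: e_def)
    finally have "2 * L * 2 powr n \<le> 2 * (2 * (1 - \<delta>) powr (1 / p) * (2 * n) powr (n + 1) * M powr (1 / p) * r powr \<delta>) * 2 powr n"
      unfolding L_def by (intro mult_right_mono mult_left_mono) auto
    also have "\<dots> = D * (1 - \<delta>) powr (1 / p) * r powr \<delta> * M powr (1 / p)"
      unfolding D_def by (simp add: powr_add)
    finally show ?thesis .
  qed
  finally show ?thesis unfolding r_def .
qed

text \<open>The single point \<open>x\<close> takes the place of the smaller cell here: on the cell, \<open>|x - y|\<close> is at most the
  diameter, so \<open>g x\<close> controls the integral of \<open>|u x - u y|\<^sup>p\<close>. There is no factor \<open>1 - \<delta>\<close>, but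
  no factor \<open>1 / \<delta>\<close> either.\<close>

lemma dist_mean_le_energy:
  assumes x: "x \<in> Q" and M: "0 < M" and le: "g x \<le> ennreal M"
  shows "\<bar>u x - mean (C k x) u\<bar> \<le> 2 * n powr (n + 1) * side k powr \<delta> * M powr (1 / p)"
proof -
  define r where "r = side k"
  have r: "0 < r" using side_pos by (simp add: r_def)
  define e where "e = n + p * \<delta>"
  define L where "L = (n powr e * M) powr (1 / p) * r powr \<delta>"
  have L: "0 < L" unfolding L_def using M n1 r by simp
  have L_powr: "L powr p = n powr e * M * r powr (p * \<delta>)"
    unfolding L_def using M r p n1 by (simp add: powr_mult powr_powr mult.commute)
  have "(\<integral>\<^sup>+y\<in>C k x. ennreal (\<bar>u x - u y\<bar> powr p) \<partial>lborel)
     \<le> (\<integral>\<^sup>+y. ennreal ((n * r) powr e) * (ennreal (\<bar>u x - u y\<bar> powr p / norm (x - y) powr e) * indicator Q y) \<partial>lborel)"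
  proof (rule nn_integral_mono)
    fix y
    show "ennreal (\<bar>u x - u y\<bar> powr p) * indicator (C k x) y
      \<le> ennreal ((n * r) powr e) * (ennreal (\<bar>u x - u y\<bar> powr p / norm (x - y) powr e) * indicator Q y)"
    proof (cases "y \<in> C k x \<and> x \<noteq> y")
      case True
      then have y: "y \<in> Q" using cell_sub_Q[OF x] by auto
      have "norm (x - y) powr e \<le> (n * r) powr e"
        using cell_diameter[OF l, of x a k x y] True p d n1 unfolding r_def e_def n by (intro powr_mono2) auto
      then have "\<bar>u x - u y\<bar> powr p * norm (x - y) powr e \<le> \<bar>u x - u y\<bar> powr p * (n * r) powr e"
        by (intro mult_left_mono) auto
      then have "\<bar>u x - u y\<bar> powr p \<le> (n * r) powr e * (\<bar>u x - u y\<bar> powr p / norm (x - y) powr e)"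
        using True by (simp add: pos_le_divide_eq mult.commute)
      then show ?thesis using y by (auto simp: indicator_def ennreal_mult[symmetric] intro!: ennreal_leI)
    qed (auto simp: indicator_def)
  qed
  also have "\<dots> = ennreal ((n * r) powr e) * g x"
    unfolding g_def e_def by (rule nn_integral_cmult) measurable
  also have "\<dots> \<le> ennreal ((n * r) powr e) * ennreal M" by (intro mult_left_mono le) auto
  also have "\<dots> = ennreal (L powr p * r ^ CARD('n))"
  proof -
    have "(n * r) powr e * M = L powr p * r ^ CARD('n)"
      unfolding L_powr side_pow[of k, folded r_def] using n1 r by (simp add: powr_mult powr_add e_def mult_ac)
    then show ?thesis using M by (subst ennreal_mult[symmetric]) auto
  qed
  finally have "\<bar>u x - mean (C k x) u\<bar> \<le> 2 * L"
    using L p l side_pos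
    by (intro dist_mean_le_powr[where p=p] set_integrable_subset[OF u_integrable] cell_sub_Q x
        cell_measure u_borel sets_cell) (auto simp: r_def sets_cell cell_measure)
  also have "L \<le> n powr (n + 1) * M powr (1 / p) * r powr \<delta>"
    unfolding L_def using powr_n_bound[of n] n1 M by (auto simp: powr_mult e_def intro!: mult_right_mono)
  finally show ?thesis unfolding r_def by (simp add: mult_ac)
qed

text \<open>By \<open>dist_mean_le_energy\<close>, finite energy at \<open>x\<close> forces the means over the cells around \<open>x\<close> to converge
  to \<open>u x\<close>, with rate \<open>2\<^bsup>-k\<delta>\<^esup>\<close>.\<close>

lemma means_tendsto:
  assumes x: "x \<in> Q" and M: "0 < M" and le: "g x \<le> ennreal M"
  shows "(\<lambda>k. mean (C k x) u) \<longlonglongrightarrow> u x"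
proof -
  have "(\<lambda>k. ((1/2) powr \<delta>) ^ k) \<longlonglongrightarrow> 0" by (rule LIMSEQ_power_zero) (use d in \<open>simp add: powr_divide gr_one_powr\<close>)
  then have "(\<lambda>k. 2 * n powr (n + 1) * l powr \<delta> * M powr (1 / p) * (((1/2) powr \<delta>) ^ k)) \<longlonglongrightarrow> 0"
    by (rule tendsto_mult_right_zero)
  then have "(\<lambda>k. mean (C k x) u - u x) \<longlonglongrightarrow> 0"
  proof (rule Lim_null_comparison[rotated], intro always_eventually allI)
    fix k
    have "side k powr \<delta> = l powr \<delta> * ((1/2) powr \<delta>) ^ k"
      using l by (simp add: powr_divide powr_power power_one_over field_simps powr_realpow[symmetric] powr_powr)
    then show "norm (mean (C k x) u - u x) \<le> 2 * n powr (n + 1) * l powr \<delta> * M powr (1 / p) * (((1/2) powr \<delta>) ^ k)"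
      using dist_mean_le_energy[OF x M le, of k] by (simp add: abs_minus_commute mult_ac)
  qed
  then show ?thesis by (simp add: LIM_zero_iff)
qed

text \<open>Fine scales. Summing \<open>mean_step\<close> costs \<open>1 / (1 - 2\<^bsup>-\<delta>\<^esup>)\<close>, which is at most \<open>4\<close> for \<open>\<delta> \<ge> 1/2\<close>. For smaller
  \<open>\<delta>\<close> the factor \<open>(1 - \<delta>)\<^bsup>1/p\<^esup>\<close> is at least \<open>1/2\<close>, and \<open>dist_mean_le_energy\<close> suffices.\<close>

lemma mean_tail:
  assumes x: "x \<in> Q" and M: "0 < M" and le: "g x \<le> ennreal M"
    and max: "\<And>j. (\<integral>\<^sup>+y\<in>C j x. g y \<partial>lborel) \<le> ennreal (M * side j powr n)"
  shows "\<bar>u x - mean (C k x) u\<bar> \<le> 4 * D * (1 - \<delta>) powr (1 / p) * side k powr \<delta> * M powr (1 / p)"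
proof (cases "\<delta> \<le> 1/2")
  case True
  have "(1/2) powr 1 \<le> (1/2) powr (1 / p)"
    using p by (intro powr_mono') auto
  also have "\<dots> \<le> (1 - \<delta>) powr (1 / p)" using True p by (intro powr_mono2) auto
  finally have half: "1/2 \<le> (1 - \<delta>) powr (1 / p)" by simp
  have "n powr (n + 1) \<le> (2 * n) powr (n + 1)" using n1 by (intro powr_mono2) auto
  also have "\<dots> \<le> D" unfolding D_def using n1 ge_one_powr_ge_zero[of 2 "n + 2"] by simp
  finally have "n powr (n + 1) * 1 \<le> D * (2 * (1 - \<delta>) powr (1 / p))"
    using half D1 by (intro mult_mono) auto
  then have "2 * (n powr (n + 1) * 1) * (side k powr \<delta> * M powr (1 / p))
     \<le> 2 * (D * (2 * (1 - \<delta>) powr (1 / p))) * (side k powr \<delta> * M powr (1 / p))"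
    by (intro mult_right_mono) auto
  then show ?thesis using dist_mean_le_energy[OF x M le, of k] by (simp add: mult_ac)
next
  case False
  define B where "B = D * (1 - \<delta>) powr (1 / p) * M powr (1 / p)"
  have B: "0 \<le> B" using D1 by (simp add: B_def)
  have step: "side j powr \<delta> \<le> 4 * (side j powr \<delta> - side (Suc j) powr \<delta>)" for j
  proof -
    \<comment> \<open>\<open>2\<^bsup>-\<delta>\<^esup> \<le> 2\<^bsup>-1/2\<^esup> \<le> 3/4\<close>, so consecutive terms differ by at least a quarter.\<close>
    have "(3/4 :: real) powr 2 \<ge> 1/2" by (simp add: power2_eq_square)
    then have "(1/2 :: real) powr (1/2) \<le> ((3/4) powr 2) powr (1/2)" by (intro powr_mono2) auto
    also have "\<dots> = 3/4" by (simp add: powr_powr del: powr_numeral)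
    finally have h: "(1/2 :: real) powr (1/2) \<le> 3/4" .
    have "(1/2) powr \<delta> \<le> (1/2) powr (1/2)" using False by (intro powr_mono') auto
    then have "(1/2) powr \<delta> \<le> 3/4" using h by linarith
    then have "side j powr \<delta> * (1/2) powr \<delta> \<le> side j powr \<delta> * (3/4)"
      by (intro mult_left_mono) auto
    moreover have "side (Suc j) powr \<delta> = side j powr \<delta> * (1/2) powr \<delta>"
      using l by (simp add: powr_mult[symmetric] mult.commute)
    ultimately show ?thesis by simp
  qed
  have tele: "\<bar>mean (C k x) u - mean (C (k + i) x) u\<bar> \<le> 4 * B * (side k powr \<delta> - side (k + i) powr \<delta>)" for i
  proof (induction i)
    case (Suc i)
    have "\<bar>mean (C (k + i) x) u - mean (C (k + Suc i) x) u\<bar> \<le> B * side (k + i) powr \<delta>"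
      using mean_step[OF x M max[of "k + i"]] by (simp add: B_def mult_ac)
    also have "\<dots> \<le> B * (4 * (side (k + i) powr \<delta> - side (Suc (k + i)) powr \<delta>))"
      using B step by (intro mult_left_mono)
    finally show ?case using Suc by (simp add: algebra_simps)
  qed simp
  have lim: "(\<lambda>i. \<bar>mean (C k x) u - mean (C (i + k) x) u\<bar>) \<longlonglongrightarrow> \<bar>mean (C k x) u - u x\<bar>"
    by (intro tendsto_intros LIMSEQ_ignore_initial_segment means_tendsto[OF x M le])
  have "\<bar>mean (C k x) u - u x\<bar> \<le> 4 * B * side k powr \<delta>"
  proof (rule LIMSEQ_le_const2[OF lim], intro exI allI impI)
    fix i
    have "4 * B * (side k powr \<delta> - side (k + i) powr \<delta>) \<le> 4 * B * side k powr \<delta>"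
      using B by (intro mult_left_mono) auto
    then show "\<bar>mean (C k x) u - mean (C (i + k) x) u\<bar> \<le> 4 * B * side k powr \<delta>"
      using tele[of i] by (simp add: add.commute)
  qed
  then show ?thesis by (simp add: B_def mult_ac abs_minus_commute)
qed

text \<open>Coarse scales. The mean of \<open>g\<close> over a cell of generation \<open>j\<close> is at most \<open>2\<^bsup>jn\<^esup>\<close> times its mean over \<open>Q\<close>, so
  the steps grow like \<open>2\<^bsup>js\<^esup>\<close>. Their geometric sum costs \<open>1 / (2\<^sup>s - 1) \<le> 2 / s\<close>: this is where the
  Sobolev exponent \<open>n / s\<close> enters the constant.\<close>

lemma mean_head:
  assumes x: "x \<in> Q" and A: "0 < A" and le: "(\<integral>\<^sup>+y\<in>Q. g y \<partial>lborel) \<le> ennreal (A powr p * l powr n)"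
  shows "\<bar>mean Q u - mean (C k x) u\<bar> \<le> D * (1 - \<delta>) powr (1 / p) * l powr \<delta> * A * (2 / s) * 2 powr (k * s)"
proof -
  define B where "B = D * (1 - \<delta>) powr (1 / p) * l powr \<delta> * A"
  have B: "0 \<le> B" using D1 A by (simp add: B_def)
  have C0: "C 0 x = Q" using cell_eqI[OF x] .
  have q: "s / 2 \<le> 2 powr s - 1"
  proof -
    have "1 + s * ln 2 \<le> 2 powr s" unfolding powr_def using exp_ge_add_one_self[of "s * ln 2"] by simp
    moreover have "s * (1/2) \<le> s * ln 2" using s_pos ln2_ge_two_thirds by (intro mult_left_mono) auto
    ultimately show ?thesis by simp
  qed
  have step: "\<bar>mean (C j x) u - mean (C (Suc j) x) u\<bar> \<le> B * (2 powr s) ^ j" for j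
  proof -
    define M where "M = A powr p * 2 powr (j * n)"
    have M: "0 < M" using A by (simp add: M_def)
    have "(\<integral>\<^sup>+y\<in>C j x. g y \<partial>lborel) \<le> (\<integral>\<^sup>+y\<in>Q. g y \<partial>lborel)"
      using cell_sub_Q[OF x, of j] by (intro nn_integral_mono mult_left_mono) (auto simp: indicator_def)
    also note le
    also have "A powr p * l powr n = M * side j powr n"
      using l by (simp add: M_def powr_divide powr_realpow[symmetric] powr_powr)
    finally have "\<bar>mean (C j x) u - mean (C (Suc j) x) u\<bar> \<le> D * (1 - \<delta>) powr (1 / p) * side j powr \<delta> * M powr (1 / p)"
      by (rule mean_step[OF x M])
    also have "M powr (1 / p) = A * 2 powr (j * n / p)"
      using A p by (simp add: M_def powr_mult powr_powr)
    also have "D * (1 - \<delta>) powr (1 / p) * side j powr \<delta> * (A * 2 powr (j * n / p)) = B * (2 powr (j * n / p) / 2 powr (j * \<delta>))"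
      using l by (simp add: B_def powr_divide powr_realpow[symmetric] powr_powr)
    also have "2 powr (j * n / p) / 2 powr (j * \<delta>) = (2 powr s) ^ j"
      by (simp add: powr_diff[symmetric] powr_realpow[symmetric] powr_powr s_def algebra_simps)
    finally show ?thesis .
  qed
  have tele: "\<bar>mean Q u - mean (C k x) u\<bar> * (2 powr s - 1) \<le> B * ((2 powr s) ^ k - 1)"
  proof (induction k)
    case 0 then show ?case by (simp add: C0)
  next
    case (Suc k)
    have "\<bar>mean Q u - mean (C (Suc k) x) u\<bar> * (2 powr s - 1)
       \<le> (\<bar>mean Q u - mean (C k x) u\<bar> + B * (2 powr s) ^ k) * (2 powr s - 1)"
      using step[of k] q s_pos by (intro mult_right_mono) auto
    then show ?case using Suc by (simp add: algebra_simps)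
  qed
  have "\<bar>mean Q u - mean (C k x) u\<bar> * (s / 2) \<le> \<bar>mean Q u - mean (C k x) u\<bar> * (2 powr s - 1)"
    using q by (intro mult_left_mono) auto
  also note tele
  also have "B * ((2 powr s) ^ k - 1) \<le> B * (2 powr s) ^ k" using B by (intro mult_left_mono) auto
  also have "(2 powr s) ^ k = 2 powr (k * s)" by (simp add: powr_realpow[symmetric] powr_powr mult.commute)
  finally show ?thesis using s_pos by (simp add: B_def field_simps)
qed

text \<open>The chain is cut at the generation \<open>k\<close> with \<open>2\<^sup>k \<le> z < 2\<^bsup>k + 1\<^esup>\<close>. Both the coarse and the fine part are
  then of order \<open>z\<^sup>s\<close>.\<close>

lemma pointwise_bound:
  assumes x: "x \<in> Q" and A: "0 < A" and z: "1 \<le> z"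
    and le: "g x \<le> ennreal (A powr p * z powr n)"
    and max: "\<And>j. (\<integral>\<^sup>+y\<in>C j x. g y \<partial>lborel) \<le> ennreal (A powr p * z powr n * side j powr n)"
    and Q: "(\<integral>\<^sup>+y\<in>Q. g y \<partial>lborel) \<le> ennreal (A powr p * l powr n)"
  shows "\<bar>u x - mean Q u\<bar> \<le> 10 * D * (n / s) * (1 - \<delta>) powr (1 / p) * l powr \<delta> * A * z powr s"
proof -
  define k where "k = nat \<lfloor>log 2 z\<rfloor>"
  define B where "B = D * (1 - \<delta>) powr (1 / p) * l powr \<delta> * A"
  have B: "0 \<le> B" using D1 A by (simp add: B_def)
  have lz: "0 \<le> log 2 z" using z by simp
  have k: "real k \<le> log 2 z" "log 2 z < real k + 1" using lz unfolding k_def by linarith+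
  have z2: "z = 2 powr (log 2 z)" using z by simp
  have head: "2 powr (k * s) \<le> z powr s"
    by (subst z2, subst powr_powr) (use k s_pos in \<open>auto intro!: powr_mono mult_right_mono\<close>)
  have tail: "side k powr \<delta> * z powr (n / p) \<le> 2 * l powr \<delta> * z powr s"
  proof -
    have "z powr \<delta> \<le> 2 powr ((k + 1) * \<delta>)"
      by (subst z2, subst powr_powr) (use k d in \<open>auto intro!: powr_mono mult_right_mono\<close>)
    also have "\<dots> = 2 powr \<delta> * 2 powr (k * \<delta>)" by (simp add: powr_add[symmetric] algebra_simps)
    also have "\<dots> \<le> 2 * 2 powr (k * \<delta>)" using powr_mono[of \<delta> 1 2] d by (intro mult_right_mono) auto
    finally have "z powr \<delta> * (z powr s / 2 powr (k * \<delta>)) \<le> 2 * 2 powr (k * \<delta>) * (z powr s / 2 powr (k * \<delta>))"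
      by (intro mult_right_mono) auto
    then have "z powr \<delta> * z powr s / 2 powr (k * \<delta>) \<le> 2 * z powr s" by simp
    then have "l powr \<delta> * (z powr \<delta> * z powr s / 2 powr (k * \<delta>)) \<le> l powr \<delta> * (2 * z powr s)"
      by (intro mult_left_mono) auto
    moreover have "z powr (n / p) = z powr \<delta> * z powr s" by (simp add: powr_add[symmetric] s_def)
    moreover have "side k powr \<delta> = l powr \<delta> / 2 powr (k * \<delta>)"
      using l by (simp add: powr_divide powr_realpow[symmetric] powr_powr)
    ultimately show ?thesis by simp
  qed
  have "\<bar>u x - mean (C k x) u\<bar> \<le> 4 * D * (1 - \<delta>) powr (1 / p) * side k powr \<delta> * (A powr p * z powr n) powr (1 / p)"
    using A z by (intro mean_tail x le max) auto
  also have "(A powr p * z powr n) powr (1 / p) = A * z powr (n / p)"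
    using A z p by (simp add: powr_mult powr_powr)
  also have "4 * D * (1 - \<delta>) powr (1 / p) * side k powr \<delta> * (A * z powr (n / p))
      = 4 * D * (1 - \<delta>) powr (1 / p) * A * (side k powr \<delta> * z powr (n / p))" by simp
  also have "\<dots> \<le> 4 * D * (1 - \<delta>) powr (1 / p) * A * (2 * l powr \<delta> * z powr s)"
    using tail D1 A by (intro mult_left_mono) auto
  finally have t: "\<bar>u x - mean (C k x) u\<bar> \<le> 8 * (B * z powr s)" by (simp add: B_def mult_ac)
  have "\<bar>mean Q u - mean (C k x) u\<bar> \<le> B * (2 / s) * 2 powr (k * s)"
    using mean_head[OF x A Q, of k] by (simp add: B_def)
  also have "\<dots> \<le> B * (2 / s) * z powr s" using head B s_pos by (intro mult_left_mono) auto
  also have "\<dots> \<le> B * (2 * (n / s)) * z powr s"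
    using B s_pos n1 by (intro mult_right_mono mult_left_mono) (auto simp: divide_right_mono)
  finally have h: "\<bar>mean Q u - mean (C k x) u\<bar> \<le> 2 * (n / s) * (B * z powr s)" by (simp add: mult_ac)
  have "1 \<le> n / s"
  proof -
    have "n / p \<le> n" using n1 p by (simp add: field_simps)
    then have "s \<le> n" using d by (simp add: s_def)
    then show ?thesis using s_pos by simp
  qed
  then have "8 * 1 * (B * z powr s) \<le> 8 * (n / s) * (B * z powr s)"
    using B by (intro mult_right_mono mult_left_mono) auto
  then have "\<bar>u x - mean Q u\<bar> \<le> 10 * (n / s) * (B * z powr s)"
    using t h by (simp only: mult.assoc)
  then show ?thesis by (simp add: B_def mult_ac)
qed

end

section \<open>The weighted weak-type inequality\<close>

lemma ennreal_le_divide_real: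
  assumes "ennreal c * X \<le> ennreal b" "0 < c" "0 \<le> b"
  shows "X \<le> ennreal (b / c)"
proof (cases X)
  case (real r)
  then show ?thesis using assms by (simp add: ennreal_mult[symmetric] pos_le_divide_eq mult.commute)
next
  case top
  then show ?thesis using assms by (simp add: ennreal_mult_top top_unique)
qed

text \<open>The \<open>A\<^sub>1\<close> condition is used in this pointwise form: at almost every point of the cube, the weight dominates its
  means over all cells containing that point, up to the factor \<open>K\<close>.\<close>

locale weighted_fractional_cube = fractional_cube n a l \<delta> p u
  for n :: real and a :: "real ^ 'n" and l \<delta> p :: real and u :: "real ^ 'n \<Rightarrow> real" +
  fixes w :: "real ^ 'n \<Rightarrow> ennreal" and K W :: real
  assumes w_borel [measurable]: "w \<in> borel_measurable borel"
    and W: "(\<integral>\<^sup>+x\<in>cell a l 0 a. w x \<partial>lborel) = ennreal W" "0 < W"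
    and K: "1 \<le> K"
    and A1: "AE y in lborel. y \<in> cell a l 0 a \<longrightarrow>
      (\<forall>k. (\<integral>\<^sup>+x\<in>cell a l k y. w x \<partial>lborel) \<le> ennreal (K * (l / 2 ^ k) powr n) * w y)"
begin

definition energy :: ennreal where "energy = (\<integral>\<^sup>+x\<in>Q. g x * w x \<partial>lborel)"

abbreviation \<omega> :: "(real ^ 'n) measure" where "\<omega> \<equiv> density lborel w"

lemma emeasure_omega: "E \<in> sets borel \<Longrightarrow> emeasure \<omega> E = (\<integral>\<^sup>+x. w x * indicator E x \<partial>lborel)"
  by (simp add: emeasure_density)

definition cell_energy :: "nat \<Rightarrow> real ^ 'n \<Rightarrow> ennreal" where
  "cell_energy k x = (\<integral>\<^sup>+y\<in>C k x. g y \<partial>lborel)"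

lemma cell_energy_borel [measurable]: "cell_energy k \<in> borel_measurable borel"
proof -
  have "cell_energy k = (\<lambda>x. \<integral>\<^sup>+y. (if y \<in> C k x then g y else 0) \<partial>lborel)"
    unfolding cell_energy_def by (intro ext nn_integral_cong) (auto simp: indicator_def)
  moreover have "\<dots> \<in> borel_measurable borel"
    by measurable
  ultimately show ?thesis by simp
qed

text \<open>Sort the points by the first generation \<open>k\<close> at which the mean of \<open>g\<close> exceeds \<open>M\<close>. The resulting set
  \<open>E k\<close> is a union of cells of generation \<open>k\<close>. In the double integral of \<open>w x * g y\<close> over pairs in a common
  cell contained in \<open>E k\<close>, integrating first in \<open>y\<close> gives at least \<open>M\<close> times the weight of \<open>E k\<close>, while
  integrating first in \<open>x\<close> replaces the mean of \<open>w\<close> by \<open>K * w y\<close>.\<close>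

lemma maximal_weak_type:
  assumes M: "0 < M"
  shows "ennreal M * emeasure \<omega> {x \<in> Q. \<exists>k. ennreal (M * side k powr n) < cell_energy k x} \<le> ennreal K * energy"
proof -
  define E where "E k = {x \<in> Q. ennreal (M * side k powr n) < cell_energy k x \<and>
      (\<forall>j<k. cell_energy j x \<le> ennreal (M * side j powr n))}" for k
  define \<nu> where "\<nu> = density lborel (\<lambda>x. g x * w x)"
  have E_sets [measurable]: "E k \<in> sets borel" for k unfolding E_def by measurable
  have E_cell: "y \<in> E k" if "x \<in> E k" "y \<in> C k x" for x y k
  proof -
    have "C j y = C j x" if "j \<le> k" for j
      using cell_antimono[OF that, of a l x] \<open>y \<in> C k x\<close> by (intro cell_eqI) auto
    then have "cell_energy j y = cell_energy j x" if "j \<le> k" for j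
      using that by (simp add: cell_energy_def)
    moreover have "y \<in> Q" using cell_sub_Q[of x k] that by (auto simp: E_def)
    ultimately show ?thesis using that(1) by (simp add: E_def)
  qed
  have level: "ennreal M * emeasure \<omega> (E k) \<le> ennreal K * emeasure \<nu> (E k)" for k
  proof -
    define m where "m = side k powr n"
    have m: "0 < m" using l by (simp add: m_def)
    have "ennreal m * (ennreal M * emeasure \<omega> (E k)) = (\<integral>\<^sup>+x. ennreal (M * m) * (w x * indicator (E k) x) \<partial>lborel)"
      using m M by (simp add: emeasure_omega nn_integral_cmult ennreal_mult mult_ac)
    also have "\<dots> \<le> (\<integral>\<^sup>+x. cell_energy k x * (w x * indicator (E k) x) \<partial>lborel)"
      by (intro nn_integral_mono) (auto simp: E_def m_def indicator_def intro!: mult_right_mono)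
    also have "\<dots> = (\<integral>\<^sup>+x. (\<integral>\<^sup>+y. (if y \<in> C k x then g y * (w x * indicator (E k) x) else 0) \<partial>lborel) \<partial>lborel)"
    proof (rule nn_integral_cong)
      fix x :: "real ^ 'n"
      have "(if y \<in> C k x then g y * (w x * indicator (E k) x) else 0)
         = (g y * indicator (C k x) y) * (w x * indicator (E k) x)" for y
        by (simp add: indicator_def)
      then show "cell_energy k x * (w x * indicator (E k) x)
          = (\<integral>\<^sup>+y. (if y \<in> C k x then g y * (w x * indicator (E k) x) else 0) \<partial>lborel)"
        by (simp add: nn_integral_multc cell_energy_def sets_cell)
    qed
    also have "\<dots> = (\<integral>\<^sup>+y. (\<integral>\<^sup>+x. (if y \<in> C k x then g y * (w x * indicator (E k) x) else 0) \<partial>lborel) \<partial>lborel)"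
      by (rule lborel_pair.Fubini') measurable
    also have "\<dots> = (\<integral>\<^sup>+y. (g y * indicator (E k) y) * (\<integral>\<^sup>+x\<in>C k y. w x \<partial>lborel) \<partial>lborel)"
    proof (rule nn_integral_cong)
      fix y :: "real ^ 'n"
      have "(if y \<in> C k x then g y * (w x * indicator (E k) x) else 0)
         = (g y * indicator (E k) y) * (w x * indicator (C k y) x)" for x
        using E_cell[of x k y] E_cell[of y k x] in_cell_commute[of x a l k y] by (auto simp: indicator_def)
      then show "(\<integral>\<^sup>+x. (if y \<in> C k x then g y * (w x * indicator (E k) x) else 0) \<partial>lborel)
          = (g y * indicator (E k) y) * (\<integral>\<^sup>+x\<in>C k y. w x \<partial>lborel)"
        by (simp add: nn_integral_cmult)
    qed
    also have "\<dots> \<le> (\<integral>\<^sup>+y. (g y * indicator (E k) y) * (ennreal (K * m) * w y) \<partial>lborel)"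
      using A1
      by (intro nn_integral_mono_AE) (auto simp: E_def m_def indicator_def intro!: mult_left_mono elim!: eventually_mono)
    also have "\<dots> = ennreal m * (ennreal K * emeasure \<nu> (E k))"
      unfolding \<nu>_def using m K
      by (simp add: emeasure_density nn_integral_cmult[symmetric] ennreal_mult mult_ac)
    finally show ?thesis using m by (subst (asm) ennreal_mult_le_mult_iff) auto
  qed
  have union: "{x \<in> Q. \<exists>k. ennreal (M * side k powr n) < cell_energy k x} = (\<Union>k. E k)"
  proof (intro equalityI subsetI)
    fix x assume x: "x \<in> {x \<in> Q. \<exists>k. ennreal (M * side k powr n) < cell_energy k x}"
    define k where "k = (LEAST k. ennreal (M * side k powr n) < cell_energy k x)"
    have "ennreal (M * side k powr n) < cell_energy k x"
      unfolding k_def using x by (auto intro: LeastI)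
    moreover have "\<forall>j<k. cell_energy j x \<le> ennreal (M * side j powr n)"
      unfolding k_def by (auto dest: not_less_Least simp: not_less)
    ultimately show "x \<in> (\<Union>k. E k)" using x by (auto simp: E_def)
  qed (auto simp: E_def)
  have disj: "disjoint_family E"
    unfolding disjoint_family_on_def E_def
  proof (intro ballI impI)
    fix i j :: nat assume "i \<noteq> j"
    then consider "i < j" | "j < i" by linarith
    then show "{x \<in> Q. ennreal (M * side i powr n) < cell_energy i x \<and> (\<forall>j<i. cell_energy j x \<le> ennreal (M * side j powr n))} \<inter>
      {x \<in> Q. ennreal (M * side j powr n) < cell_energy j x \<and> (\<forall>i<j. cell_energy i x \<le> ennreal (M * side i powr n))} = {}"
      by cases (auto simp: not_less[symmetric])
  qed
  have "ennreal M * emeasure \<omega> (\<Union>k. E k) = (\<Sum>k. ennreal M * emeasure \<omega> (E k))"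
    using disj by (subst suminf_emeasure[symmetric]) auto
  also have "\<dots> \<le> (\<Sum>k. ennreal K * emeasure \<nu> (E k))" by (intro suminf_le level) auto
  also have "\<dots> = ennreal K * emeasure \<nu> (\<Union>k. E k)"
    using disj by (subst suminf_emeasure[symmetric]) (auto simp: \<nu>_def)
  also have "\<dots> \<le> ennreal K * emeasure \<nu> Q"
    by (intro mult_left_mono emeasure_mono) (auto simp: E_def \<nu>_def sets_cell)
  also have "emeasure \<nu> Q = energy"
    unfolding \<nu>_def energy_def by (simp add: emeasure_density sets_cell)
  finally show ?thesis unfolding union .
qed

text \<open>This is how \<open>A\<close> is to be read: \<open>A\<^sup>p\<close> bounds \<open>K\<close> times the weighted mean of \<open>g\<close> over \<open>Q\<close>, and hence, by the
  \<open>A\<^sub>1\<close> condition on \<open>Q\<close> itself, the unweighted mean of \<open>g\<close>.\<close>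

lemma cube_energy_le:
  assumes A: "0 < A" and E: "ennreal K * energy \<le> ennreal (A powr p * W)"
  shows "(\<integral>\<^sup>+y\<in>Q. g y \<partial>lborel) \<le> ennreal (A powr p * l powr n)"
proof -
  have "ennreal W * (\<integral>\<^sup>+y\<in>Q. g y \<partial>lborel) = (\<integral>\<^sup>+y. (g y * indicator Q y) * ennreal W \<partial>lborel)"
    by (subst nn_integral_multc) (auto simp: mult.commute)
  also have "\<dots> \<le> (\<integral>\<^sup>+y. ennreal (l powr n) * (ennreal K * (g y * w y * indicator Q y)) \<partial>lborel)"
  proof (intro nn_integral_mono_AE, use A1 in eventually_elim)
    fix y assume y: "y \<in> Q \<longrightarrow> (\<forall>k. (\<integral>\<^sup>+x\<in>C k y. w x \<partial>lborel) \<le> ennreal (K * side k powr n) * w y)"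
    show "(g y * indicator Q y) * ennreal W \<le> ennreal (l powr n) * (ennreal K * (g y * w y * indicator Q y))"
    proof (cases "y \<in> Q")
      case True
      then have "C 0 y = Q" by (rule cell_eqI)
      then have "ennreal W \<le> ennreal (K * l powr n) * w y" using y True W(1) by (auto dest: spec[of _ 0])
      then have "g y * ennreal W \<le> g y * (ennreal (K * l powr n) * w y)" by (intro mult_left_mono) auto
      then show ?thesis using True K by (simp add: ennreal_mult mult_ac)
    qed simp
  qed
  also have "\<dots> = ennreal (l powr n) * (ennreal K * energy)"
    unfolding energy_def by (simp add: nn_integral_cmult)
  also have "\<dots> \<le> ennreal (l powr n) * ennreal (A powr p * W)" by (intro mult_left_mono E) auto
  also have "\<dots> = ennreal (l powr n * (A powr p * W))" using W by (simp add: ennreal_mult)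
  finally have "(\<integral>\<^sup>+y\<in>Q. g y \<partial>lborel) \<le> ennreal (l powr n * (A powr p * W) / W)"
    using W by (intro ennreal_le_divide_real) auto
  then show ?thesis using W by (simp add: mult_ac)
qed

definition weak_const :: real where
  "weak_const = 10 * D * (n / s) * (1 - \<delta>) powr (1 / p) * l powr \<delta>"

lemma weak_const_pos: "0 < weak_const"
  unfolding weak_const_def using D1 n1 s_pos d l by simp

text \<open>Outside the set where \<open>g\<close> or its dyadic maximal function exceeds \<open>M = A\<^sup>p z\<^sup>n\<close>, the oscillation is at most
  \<open>weak_const * A * z\<^sup>s\<close>. With \<open>z\<close> chosen to make this equal to \<open>t\<close>, the exceptional
  set has weight at most \<open>2 W / z\<^sup>n\<close>, and \<open>z\<^sup>n\<close> is the power \<open>n / s\<close> of \<open>t / (weak_const * A)\<close>.\<close>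

lemma weak_type:
  assumes A: "0 < A" and E: "ennreal K * energy \<le> ennreal (A powr p * W)" and t: "0 < t"
  shows "emeasure \<omega> {x \<in> Q. t < \<bar>u x - mean Q u\<bar>} \<le> ennreal (2 * W * (weak_const * A / t) powr (n / s))"
proof (cases "t < weak_const * A")
  case True
  have "emeasure \<omega> {x \<in> Q. t < \<bar>u x - mean Q u\<bar>} \<le> emeasure \<omega> Q"
    by (intro emeasure_mono) (auto simp: sets_cell)
  also have "\<dots> = ennreal W" using W by (simp add: emeasure_omega sets_cell)
  also have "\<dots> \<le> ennreal (2 * W * (weak_const * A / t) powr (n / s))"
  proof (rule ennreal_leI)
    have "1 \<le> (weak_const * A / t) powr (n / s)"
      using True t n1 s_pos by (intro ge_one_powr_ge_zero) auto
    then have "2 * W * 1 \<le> 2 * W * (weak_const * A / t) powr (n / s)" using W by (intro mult_left_mono) auto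
    then show "W \<le> 2 * W * (weak_const * A / t) powr (n / s)" using W by linarith
  qed
  finally show ?thesis .
next
  case False
  define z where "z = (t / (weak_const * A)) powr (1 / s)"
  define M where "M = A powr p * z powr n"
  have cA: "0 < weak_const * A" using weak_const_pos A by simp
  have z: "1 \<le> z" unfolding z_def using False cA s_pos by (intro ge_one_powr_ge_zero) auto
  have zs: "weak_const * A * z powr s = t"
    unfolding z_def using weak_const_pos A t s_pos by (simp add: powr_powr)
  have M: "0 < M" using A z by (simp add: M_def)
  define B1 where "B1 = {x \<in> Q. \<exists>k. ennreal (M * side k powr n) < cell_energy k x}"
  define B2 where "B2 = {x \<in> Q. ennreal M < g x}"
  have [measurable]: "B1 \<in> sets borel" "B2 \<in> sets borel" unfolding B1_def B2_def by measurable
  have sub: "{x \<in> Q. t < \<bar>u x - mean Q u\<bar>} \<subseteq> B1 \<union> B2"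
  proof
    fix x assume x: "x \<in> {x \<in> Q. t < \<bar>u x - mean Q u\<bar>}"
    show "x \<in> B1 \<union> B2"
    proof (rule ccontr)
      assume "x \<notin> B1 \<union> B2"
      then have "g x \<le> ennreal M" "\<And>j. cell_energy j x \<le> ennreal (M * side j powr n)"
        using x by (auto simp: B1_def B2_def not_less)
      then have "\<bar>u x - mean Q u\<bar> \<le> weak_const * A * z powr s"
        unfolding weak_const_def using x
        by (intro pointwise_bound A z cube_energy_le[OF A E]) (auto simp: M_def cell_energy_def)
      then show False using x zs by simp
    qed
  qed
  have "ennreal M * emeasure \<omega> B1 \<le> ennreal (A powr p * W)"
    using maximal_weak_type[OF M] E unfolding B1_def by (rule order_trans)
  then have b1: "emeasure \<omega> B1 \<le> ennreal (A powr p * W / M)"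
    using M W by (intro ennreal_le_divide_real) auto
  have "ennreal M * emeasure \<omega> B2 = (\<integral>\<^sup>+x. ennreal M * (w x * indicator B2 x) \<partial>lborel)"
    by (simp add: emeasure_omega nn_integral_cmult)
  also have "\<dots> \<le> energy"
    unfolding energy_def by (intro nn_integral_mono) (auto simp: B2_def indicator_def intro!: mult_right_mono)
  also have "\<dots> \<le> ennreal K * energy"
    using K mult_right_mono[of 1 "ennreal K" energy] by simp
  also note E
  finally have b2: "emeasure \<omega> B2 \<le> ennreal (A powr p * W / M)"
    using M W by (intro ennreal_le_divide_real) auto
  have "emeasure \<omega> {x \<in> Q. t < \<bar>u x - mean Q u\<bar>} \<le> emeasure \<omega> (B1 \<union> B2)"
    by (intro emeasure_mono sub) auto
  also have "\<dots> \<le> emeasure \<omega> B1 + emeasure \<omega> B2" by (intro emeasure_subadditive) auto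
  also have "\<dots> \<le> ennreal (A powr p * W / M) + ennreal (A powr p * W / M)" by (intro add_mono b1 b2)
  also have "\<dots> = ennreal (2 * (A powr p * W / M))" using W M A by (simp flip: ennreal_plus)
  also have "A powr p * W / M = W * (weak_const * A / t) powr (n / s)"
  proof -
    have "z powr n = (t / (weak_const * A)) powr (n / s)" unfolding z_def by (simp add: powr_powr)
    also have "\<dots> = 1 / (weak_const * A / t) powr (n / s)" using cA t by (simp add: powr_divide)
    finally show ?thesis using A by (simp add: M_def)
  qed
  finally show ?thesis by (simp add: mult.assoc)
qed

end

section \<open>From weak type to strong type by truncation\<close>

lemma sum_powr_le_powr_sum:
  fixes f :: "'i \<Rightarrow> real"
  assumes fin: "finite I" and f: "\<And>i. i \<in> I \<Longrightarrow> 0 \<le> f i" and r: "1 \<le> r"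
  shows "(\<Sum>i\<in>I. f i powr r) \<le> (\<Sum>i\<in>I. f i) powr r"
proof -
  define S where "S = (\<Sum>i\<in>I. f i)"
  have S: "0 \<le> S" unfolding S_def using f by (intro sum_nonneg) auto
  have split: "x powr r = x * x powr (r - 1)" if "0 \<le> x" for x :: real
    using that r by (cases "x = 0") (auto simp: powr_diff)
  have "f i powr r \<le> f i * S powr (r - 1)" if i: "i \<in> I" for i
  proof -
    have "f i \<le> S" unfolding S_def using fin f i by (intro member_le_sum) auto
    then show ?thesis unfolding split[OF f[OF i]] using f[OF i] r by (intro mult_left_mono powr_mono2) auto
  qed
  then have "(\<Sum>i\<in>I. f i powr r) \<le> (\<Sum>i\<in>I. f i * S powr (r - 1))" by (rule sum_mono)
  also have "\<dots> = S powr r" unfolding split[OF S] by (simp add: S_def sum_distrib_right)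
  finally show ?thesis unfolding S_def .
qed

text \<open>The part of \<open>z\<close> between the heights \<open>T 2\<^sup>k\<close> and \<open>T 2\<^bsup>k + 1\<^esup>\<close>. The thickness \<open>T 2\<^sup>k\<close> of a layer
  is comparable to its height.\<close>

definition layer :: "real \<Rightarrow> nat \<Rightarrow> real \<Rightarrow> real" where
  "layer T k z = min z (T * 2 ^ Suc k) - min z (T * 2 ^ k)"

lemma layer_measurable [measurable]: "layer T k \<in> borel_measurable borel"
  unfolding layer_def by measurable

lemma layer_bounds:
  assumes "0 < T"
  shows "0 \<le> layer T k z" "layer T k z \<le> T * 2 ^ k"
    and "z \<le> T * 2 ^ k \<Longrightarrow> layer T k z = 0"
    and "T * 2 ^ Suc k \<le> z \<Longrightarrow> layer T k z = T * 2 ^ k"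
proof -
  have "0 < T * 2 ^ k" using assms by simp
  then show "0 \<le> layer T k z" "layer T k z \<le> T * 2 ^ k"
    "z \<le> T * 2 ^ k \<Longrightarrow> layer T k z = 0"
    "T * 2 ^ Suc k \<le> z \<Longrightarrow> layer T k z = T * 2 ^ k"
    unfolding layer_def by (auto simp: min_def)
qed

text \<open>Layers are monotone functions whose sum telescopes to a function with Lipschitz constant \<open>1\<close>, so their increments
  add up to at most \<open>|x - y|\<close>; and \<open>p\<close>-th powers with \<open>p \<ge> 1\<close> are superadditive. For this reason the
  energies of the layers of \<open>u\<close> add up to at most the energy of \<open>u\<close>.\<close>

lemma sum_layer_diff_powr_le:
  assumes T: "0 < T" and p: "1 \<le> p"
  shows "(\<Sum>k<N. \<bar>layer T k x - layer T k y\<bar> powr p) \<le> \<bar>x - y\<bar> powr p"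
proof -
  have mono: "layer T k y \<le> layer T k x" if "y \<le> x" for x y k
  proof -
    have "0 < T * 2 ^ k" using T by simp
    then show ?thesis using that unfolding layer_def by (auto simp: min_def)
  qed
  have lip: "(\<Sum>k<N. \<bar>layer T k x - layer T k y\<bar>) \<le> \<bar>x - y\<bar>" if xy: "y \<le> x" for x y
  proof -
    have tele: "(\<Sum>k<N. layer T k z) = min z (T * 2 ^ N) - min z T" for z
      unfolding layer_def by (subst sum_lessThan_telescope) simp
    have "T \<le> T * 2 ^ N" using T mult_left_mono[of 1 "2 ^ N" T] by simp
    then have "(min x (T * 2 ^ N) - min x T) - (min y (T * 2 ^ N) - min y T) \<le> x - y"
      using xy by (auto simp: min_def)
    moreover have "(\<Sum>k<N. \<bar>layer T k x - layer T k y\<bar>) = (\<Sum>k<N. layer T k x) - (\<Sum>k<N. layer T k y)"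
      using mono[OF xy] by (simp add: sum_subtractf)
    ultimately show ?thesis using xy by (simp only: tele abs_of_nonneg diff_ge_0_iff_ge)
  qed
  have "(\<Sum>k<N. \<bar>layer T k x - layer T k y\<bar> powr p) \<le> (\<Sum>k<N. \<bar>layer T k x - layer T k y\<bar>) powr p"
    by (intro sum_powr_le_powr_sum p) auto
  also have "(\<Sum>k<N. \<bar>layer T k x - layer T k y\<bar>) \<le> \<bar>x - y\<bar>"
    using lip[of y x] lip[of x y] by (cases "y \<le> x") (auto simp: abs_minus_commute)
  then have "(\<Sum>k<N. \<bar>layer T k x - layer T k y\<bar>) powr p \<le> \<bar>x - y\<bar> powr p"
    using p by (intro powr_mono2 sum_nonneg) auto
  finally show ?thesis .
qed

context weighted_fractional_cube
begin

text \<open>Let \<open>v = |u - mean Q u|\<close>, with layers \<open>f k\<close> above the height \<open>T\<close>. By \<open>weak_type\<close> for \<open>u\<close>, the choice of \<open>T\<close> makes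
  \<open>v \<le> T\<close> on at least half of \<open>Q\<close>, measured by \<open>w\<close>. Every layer therefore vanishes on half of \<open>Q\<close> and is full on
  \<open>{v > \<tau> (k + 1)}\<close>, so that, wherever its mean lies, it deviates from this mean by more than
  \<open>\<tau> k / 4\<close> on a set of at least the weight of \<open>{v > \<tau> (k + 1)}\<close>. Now \<open>weak_type\<close> for the layer bounds the
  weight of that set by the energy of the layer to the power \<open>q / p \<ge> 1\<close>, and the energies are summable.\<close>

lemma strong_type:
  assumes A: "0 < A" and E: "ennreal K * energy \<le> ennreal (A powr p * W)"
  shows "(\<integral>\<^sup>+x\<in>Q. ennreal (\<bar>u x - mean Q u\<bar> powr (n / s)) * w x \<partial>lborel)
    \<le> ennreal (W * (96 * weak_const * A) powr (n / s))"
proof -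
  define q where "q = n / s"
  define c where "c = weak_const"
  define T where "T = 4 * c * A"
  define v where "v x = \<bar>u x - mean Q u\<bar>" for x
  define \<tau> where "\<tau> k = T * 2 ^ k" for k :: nat
  define f where "f k x = layer T k (v x)" for k x
  have v_borel [measurable]: "v \<in> borel_measurable borel" unfolding v_def by measurable
  have f_borel [measurable]: "f k \<in> borel_measurable borel" for k unfolding f_def by measurable
  have c: "0 < c" using weak_const_pos by (simp add: c_def)
  have T: "0 < T" using c A by (simp add: T_def)
  have tau: "0 < \<tau> k" "\<tau> (Suc k) = 2 * \<tau> k" "T \<le> \<tau> k" for k
    using T by (simp_all add: \<tau>_def)
  have qp: "p \<le> q" "1 \<le> q"
  proof -
    have "s \<le> n / p" using d by (simp add: s_def)
    then have "p * s \<le> n" using p by (simp add: field_simps)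
    then show "p \<le> q" unfolding q_def using s_pos by (simp add: pos_le_divide_eq)
    then show "1 \<le> q" using p by simp
  qed
  have integrable_f: "set_integrable lborel Q (f k)" for k
    unfolding set_integrable_def
    by (rule integrableI_bounded_set_indicator[where B="\<tau> k"])
       (use layer_bounds[OF T, of k] cell_measure[of 0 a] in \<open>auto simp: f_def \<tau>_def sets_cell\<close>)
  have V: "weighted_fractional_cube n a l \<delta> p (f k) w K W" for k
    by unfold_locales (use l p d n subcritical integrable_f W K A1 in auto)
  define e where "e k = weighted_fractional_cube.energy n a l \<delta> p (f k) w" for k
  have e_eq: "e k = (\<integral>\<^sup>+x\<in>Q. (\<integral>\<^sup>+y\<in>Q. ennreal (\<bar>f k x - f k y\<bar> powr p / norm (x - y) powr (n + p * \<delta>)) \<partial>lborel) * w x \<partial>lborel)" for k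
    unfolding e_def weighted_fractional_cube.energy_def[OF V]
      fractional_cube.g_def[OF weighted_fractional_cube.axioms(1)[OF V]] ..
  have sum_e: "(\<Sum>k. e k) \<le> energy"
  proof -
    have pt: "(\<Sum>k. ennreal (\<bar>f k x - f k y\<bar> powr p / norm (x - y) powr (n + p * \<delta>)))
        \<le> ennreal (\<bar>u x - u y\<bar> powr p / norm (x - y) powr (n + p * \<delta>))" for x y
    proof (rule suminf_le_const[OF summableI])
      fix N
      have "(\<Sum>k<N. \<bar>f k x - f k y\<bar> powr p) \<le> \<bar>v x - v y\<bar> powr p"
        unfolding f_def by (rule sum_layer_diff_powr_le[OF T p])
      also have "\<dots> \<le> \<bar>u x - u y\<bar> powr p" unfolding v_def using p by (intro powr_mono2) auto
      finally have "(\<Sum>k<N. \<bar>f k x - f k y\<bar> powr p / norm (x - y) powr (n + p * \<delta>))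
          \<le> \<bar>u x - u y\<bar> powr p / norm (x - y) powr (n + p * \<delta>)"
        unfolding sum_divide_distrib[symmetric] by (intro divide_right_mono) auto
      then show "(\<Sum>k<N. ennreal (\<bar>f k x - f k y\<bar> powr p / norm (x - y) powr (n + p * \<delta>)))
          \<le> ennreal (\<bar>u x - u y\<bar> powr p / norm (x - y) powr (n + p * \<delta>))"
        by (subst sum_ennreal) (auto intro: ennreal_leI)
    qed
    define h where "h k x y = ennreal (\<bar>f k x - f k y\<bar> powr p / norm (x - y) powr (n + p * \<delta>))" for k x y
    have h_borel [measurable]: "(\<lambda>z. h k (fst z) (snd z)) \<in> borel_measurable (borel \<Otimes>\<^sub>M borel)" for k
      unfolding h_def by measurable
    have h_borel' [measurable]: "h k x \<in> borel_measurable borel" for k x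
      unfolding h_def by measurable
    have inner [measurable]: "(\<lambda>x. \<integral>\<^sup>+y\<in>Q. h k x y \<partial>lborel) \<in> borel_measurable borel" for k
      unfolding h_def by measurable
    have "(\<Sum>k. e k) = (\<integral>\<^sup>+x. (\<Sum>k. (\<integral>\<^sup>+y\<in>Q. h k x y \<partial>lborel) * w x * indicator Q x) \<partial>lborel)"
      unfolding e_eq h_def[symmetric] by (rule nn_integral_suminf[symmetric]) measurable
    also have "\<dots> = (\<integral>\<^sup>+x\<in>Q. (\<integral>\<^sup>+y\<in>Q. (\<Sum>k. h k x y) \<partial>lborel) * w x \<partial>lborel)"
    proof (rule nn_integral_cong)
      fix x
      have "(\<Sum>k. (\<integral>\<^sup>+y\<in>Q. h k x y \<partial>lborel)) = (\<integral>\<^sup>+y. (\<Sum>k. h k x y * indicator Q y) \<partial>lborel)"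
        by (rule nn_integral_suminf[symmetric]) measurable
      then show "(\<Sum>k. (\<integral>\<^sup>+y\<in>Q. h k x y \<partial>lborel) * w x * indicator Q x)
          = (\<integral>\<^sup>+y\<in>Q. (\<Sum>k. h k x y) \<partial>lborel) * w x * indicator Q x"
        by (simp only: ennreal_suminf_multc)
    qed
    also have "\<dots> \<le> energy"
      unfolding energy_def g_def h_def by (intro nn_integral_mono mult_right_mono pt) auto
    finally show ?thesis .
  qed
  define \<sigma> where "\<sigma> k = enn2real (ennreal K * e k) / W" for k
  have \<sigma>: "0 \<le> \<sigma> k" for k unfolding \<sigma>_def using W by simp
  have sum_Ke: "(\<Sum>k<N. ennreal K * e k) \<le> ennreal (A powr p * W)" for N
  proof -
    have "(\<Sum>k<N. ennreal K * e k) = ennreal K * (\<Sum>k<N. e k)" by (simp add: sum_distrib_left)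
    also have "\<dots> \<le> ennreal K * (\<Sum>k. e k)" by (intro mult_left_mono sum_le_suminf) auto
    also have "\<dots> \<le> ennreal K * energy" by (intro mult_left_mono sum_e) auto
    finally show ?thesis using E by simp
  qed
  have Ke: "ennreal K * e k = ennreal (\<sigma> k * W)" for k
  proof -
    have "ennreal K * e k \<le> (\<Sum>k<Suc k. ennreal K * e k)" by (rule member_le_sum) auto
    also have "\<dots> < top" using sum_Ke[of "Suc k"] by (rule order_le_less_trans) simp
    finally show ?thesis unfolding \<sigma>_def using W by simp
  qed
  have sum_sigma: "(\<Sum>k<N. \<sigma> k) \<le> A powr p" for N
  proof -
    have "ennreal ((\<Sum>k<N. \<sigma> k) * W) = (\<Sum>k<N. ennreal K * e k)"
      unfolding Ke sum_distrib_right using \<sigma> W by (subst sum_ennreal) auto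
    also note sum_Ke
    finally show ?thesis using W A by (subst (asm) ennreal_le_iff) auto
  qed
  \<comment> \<open>The summand \<open>A\<^sup>p / 2\<^bsup>k + 1\<^esup>\<close> keeps the constants positive when a layer has no energy.\<close>
  define b where "b k = \<sigma> k + A powr p * (1/2) ^ Suc k" for k
  define B where "B k = b k powr (1 / p)" for k
  have b: "0 < b k" for k unfolding b_def using \<sigma>[of k] A by (simp add: add_nonneg_pos)
  have B: "0 < B k" for k unfolding B_def using b[of k] by simp
  have B_p: "B k powr p = b k" for k unfolding B_def using b[of k] p by (simp add: powr_powr)
  have sum_b: "(\<Sum>k<N. b k) \<le> 2 * A powr p" for N
  proof -
    have "(\<Sum>k<N. (1/2 :: real) ^ Suc k) = 1 - (1/2) ^ N" by (induction N) auto
    then have "A powr p * (\<Sum>k<N. (1/2 :: real) ^ Suc k) \<le> A powr p * 1" by (intro mult_left_mono) auto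
    then show ?thesis using sum_sigma[of N] by (simp add: b_def sum.distrib sum_distrib_left)
  qed
  have sum_B: "(\<Sum>k<N. B k powr q) \<le> (2 * A) powr q" for N
  proof -
    have "B k powr q = b k powr (q / p)" for k unfolding B_def by (simp add: powr_powr)
    then have "(\<Sum>k<N. B k powr q) = (\<Sum>k<N. b k powr (q / p))" by simp
    also have "\<dots> \<le> (\<Sum>k<N. b k) powr (q / p)"
      using b qp p by (intro sum_powr_le_powr_sum) (auto intro: less_imp_le)
    also have "\<dots> \<le> (2 * A powr p) powr (q / p)"
      using sum_b b qp p by (intro powr_mono2 sum_nonneg) (auto intro: less_imp_le)
    also have "\<dots> = 2 powr (q / p) * A powr q" using A p by (simp add: powr_mult powr_powr)
    also have "\<dots> \<le> 2 powr q * A powr q"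
    proof (intro mult_right_mono powr_mono)
      show "q / p \<le> q" using p qp mult_left_mono[of 1 p q] by (simp add: pos_divide_le_eq)
    qed auto
    finally show ?thesis using A by (simp add: powr_mult)
  qed
  have sets: "{x \<in> Q. P (v x)} \<in> sets borel" if [measurable]: "Measurable.pred borel P" for P
    by measurable
  have half: "emeasure \<omega> {x \<in> Q. \<tau> k < v x} \<le> ennreal (W / 2)" for k
  proof -
    have "emeasure \<omega> {x \<in> Q. \<tau> k < v x} \<le> emeasure \<omega> {x \<in> Q. T < v x}"
      using tau(3)[of k] by (intro emeasure_mono) (auto intro!: sets)
    also have "\<dots> \<le> ennreal (2 * W * (c * A / T) powr q)"
      using weak_type[OF A E T] unfolding v_def c_def q_def .
    also have "\<dots> \<le> ennreal (W / 2)"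
    proof (rule ennreal_leI)
      have "(c * A / T) powr q = (1/4) powr q" unfolding T_def using c A by simp
      also have "\<dots> \<le> (1/4) powr 1" using qp by (intro powr_mono') auto
      finally have "2 * W * (c * A / T) powr q \<le> 2 * W * (1/4)" using W by (intro mult_left_mono) auto
      then show "2 * W * (c * A / T) powr q \<le> W / 2" by simp
    qed
    finally show ?thesis .
  qed
  have lower: "emeasure \<omega> {x \<in> Q. \<tau> k < v x} \<le> emeasure \<omega> {x \<in> Q. v x \<le> \<tau> k}" for k
  proof -
    have "emeasure \<omega> {x \<in> Q. \<tau> k < v x} + emeasure \<omega> {x \<in> Q. v x \<le> \<tau> k}
        = emeasure \<omega> ({x \<in> Q. \<tau> k < v x} \<union> {x \<in> Q. v x \<le> \<tau> k})"
      by (intro plus_emeasure) (auto intro!: sets)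
    also have "{x \<in> Q. \<tau> k < v x} \<union> {x \<in> Q. v x \<le> \<tau> k} = Q" by auto
    also have "emeasure \<omega> Q = ennreal W" using W by (simp add: emeasure_omega sets_cell)
    finally have eq: "emeasure \<omega> {x \<in> Q. \<tau> k < v x} + emeasure \<omega> {x \<in> Q. v x \<le> \<tau> k} = ennreal W" .
    then obtain y where y: "emeasure \<omega> {x \<in> Q. v x \<le> \<tau> k} = ennreal y" "0 \<le> y"
      by (cases "emeasure \<omega> {x \<in> Q. v x \<le> \<tau> k}") auto
    obtain r where r: "emeasure \<omega> {x \<in> Q. \<tau> k < v x} = ennreal r" "0 \<le> r"
      using half[of k] by (cases "emeasure \<omega> {x \<in> Q. \<tau> k < v x}") (auto simp: top_unique)
    have "r + y = W" using eq W y r by (simp flip: ennreal_plus)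
    moreover have "r \<le> W / 2" using half[of k] r W by simp
    ultimately show ?thesis using y r by simp
  qed
  have level: "emeasure \<omega> {x \<in> Q. \<tau> (Suc k) < v x} \<le> ennreal (2 * W * (c * B k / (\<tau> k / 4)) powr q)" for k
  proof -
    define m where "m = mean Q (f k)"
    have "emeasure \<omega> {x \<in> Q. \<tau> (Suc k) < v x} \<le> emeasure \<omega> {x \<in> Q. \<tau> k / 4 < \<bar>f k x - m\<bar>}"
    proof (cases "m \<le> \<tau> k / 2")
      case True
      have "\<tau> k / 4 < \<bar>f k x - m\<bar>" if "\<tau> (Suc k) < v x" for x
        using layer_bounds(4)[OF T, of k "v x"] that True tau(1)[of k] by (simp add: f_def \<tau>_def)
      then show ?thesis by (intro emeasure_mono) auto
    next
      case False
      have "\<tau> k / 4 < \<bar>f k x - m\<bar>" if "v x \<le> \<tau> k" for x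
        using layer_bounds(3)[OF T, of "v x" k] that False tau(1)[of k] by (simp add: f_def \<tau>_def)
      then have "emeasure \<omega> {x \<in> Q. v x \<le> \<tau> k} \<le> emeasure \<omega> {x \<in> Q. \<tau> k / 4 < \<bar>f k x - m\<bar>}"
        by (intro emeasure_mono) auto
      moreover have "emeasure \<omega> {x \<in> Q. \<tau> (Suc k) < v x} \<le> emeasure \<omega> {x \<in> Q. \<tau> k < v x}"
        using tau(1,2)[of k] by (intro emeasure_mono) (auto intro!: sets)
      ultimately show ?thesis using lower[of k] by simp
    qed
    also have "\<dots> \<le> ennreal (2 * W * (c * B k / (\<tau> k / 4)) powr q)"
      unfolding m_def c_def q_def
      by (rule weighted_fractional_cube.weak_type[OF V])
         (use B[of k] tau(1)[of k] Ke[of k] W A in \<open>auto simp: B_p b_def e_def[symmetric] intro!: ennreal_leI mult_right_mono\<close>)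
    finally show ?thesis .
  qed
  have pt: "ennreal (v x powr q) \<le> ennreal ((2 * T) powr q)
      + (\<Sum>k. ennreal ((4 * \<tau> k) powr q) * indicator {x \<in> Q. \<tau> (Suc k) < v x} x)" if x: "x \<in> Q" for x
  proof (cases "v x \<le> 2 * T")
    case True
    then have "ennreal (v x powr q) \<le> ennreal ((2 * T) powr q)"
      using qp by (intro ennreal_leI powr_mono2) (auto simp: v_def)
    then show ?thesis by (rule add_increasing2[rotated]) simp
  next
    case False
    obtain N :: nat where "v x / T < 2 ^ N" using real_arch_pow[of 2 "v x / T"] by auto
    then have N: "v x \<le> \<tau> N" using T by (simp add: \<tau>_def field_simps)
    define j where "j = (LEAST j. v x \<le> \<tau> j)"
    have j: "v x \<le> \<tau> j" unfolding j_def using N by (rule LeastI)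
    have "\<not> v x \<le> \<tau> 0" "\<not> v x \<le> \<tau> 1" using False T by (auto simp: \<tau>_def)
    then have "j \<noteq> 0" "j \<noteq> 1" using j by metis+
    then obtain k where k: "j = Suc (Suc k)" by (metis One_nat_def not0_implies_Suc)
    have "\<not> v x \<le> \<tau> (Suc k)" using not_less_Least[of "Suc k" "\<lambda>j. v x \<le> \<tau> j"] k unfolding j_def by simp
    then have in_k: "x \<in> {x \<in> Q. \<tau> (Suc k) < v x}" using x by auto
    have "v x \<le> 4 * \<tau> k" using j unfolding k by (simp add: tau(2))
    then have "ennreal (v x powr q) \<le> ennreal ((4 * \<tau> k) powr q)"
      using qp by (intro ennreal_leI powr_mono2) (auto simp: v_def)
    also have "\<dots> = (\<Sum>k\<in>{k}. ennreal ((4 * \<tau> k) powr q) * indicator {x \<in> Q. \<tau> (Suc k) < v x} x)"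
      using in_k by simp
    also have "\<dots> \<le> (\<Sum>k. ennreal ((4 * \<tau> k) powr q) * indicator {x \<in> Q. \<tau> (Suc k) < v x} x)"
      by (rule sum_le_suminf) auto
    finally show ?thesis by (rule add_increasing[rotated]) simp
  qed
  have E_sets [measurable]: "{x \<in> Q. \<tau> (Suc k) < v x} \<in> sets borel" for k by (intro sets) auto
  have "(\<integral>\<^sup>+x\<in>Q. ennreal (v x powr q) * w x \<partial>lborel)
     \<le> (\<integral>\<^sup>+x. ennreal ((2 * T) powr q) * (w x * indicator Q x)
        + (\<Sum>k. ennreal ((4 * \<tau> k) powr q) * (w x * indicator {x \<in> Q. \<tau> (Suc k) < v x} x)) \<partial>lborel)"
  proof (rule nn_integral_mono)
    fix x :: "real ^ 'n"
    show "ennreal (v x powr q) * w x * indicator Q x \<le> ennreal ((2 * T) powr q) * (w x * indicator Q x)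
        + (\<Sum>k. ennreal ((4 * \<tau> k) powr q) * (w x * indicator {x \<in> Q. \<tau> (Suc k) < v x} x))"
    proof (cases "x \<in> Q")
      case True
      have "ennreal (v x powr q) * w x \<le> (ennreal ((2 * T) powr q)
        + (\<Sum>k. ennreal ((4 * \<tau> k) powr q) * indicator {x \<in> Q. \<tau> (Suc k) < v x} x)) * w x"
        by (intro mult_right_mono pt[OF True]) auto
      then show ?thesis using True
        by (simp add: distrib_left distrib_right mult_ac flip: ennreal_suminf_cmult)
    qed simp
  qed
  also have "\<dots> = ennreal ((2 * T) powr q) * ennreal W
        + (\<Sum>k. ennreal ((4 * \<tau> k) powr q) * emeasure \<omega> {x \<in> Q. \<tau> (Suc k) < v x})"
    using W by (subst nn_integral_add) (auto simp: nn_integral_suminf nn_integral_cmult emeasure_omega)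
  also have "\<dots> \<le> ennreal ((2 * T) powr q) * ennreal W + ennreal (2 * W * (32 * c * A) powr q)"
  proof (intro add_left_mono suminf_le_const[OF summableI])
    fix N
    have summand: "ennreal ((4 * \<tau> k) powr q) * emeasure \<omega> {x \<in> Q. \<tau> (Suc k) < v x} \<le> ennreal (2 * W * (16 * c) powr q * B k powr q)" for k
    proof -
      have "ennreal ((4 * \<tau> k) powr q) * emeasure \<omega> {x \<in> Q. \<tau> (Suc k) < v x}
         \<le> ennreal ((4 * \<tau> k) powr q) * ennreal (2 * W * (c * B k / (\<tau> k / 4)) powr q)"
        by (intro mult_left_mono level) auto
      also have "\<dots> = ennreal ((4 * \<tau> k) powr q * (2 * W * (c * B k / (\<tau> k / 4)) powr q))"
        using W by (intro ennreal_mult[symmetric]) auto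
      also have "(4 * \<tau> k) powr q * (2 * W * (c * B k / (\<tau> k / 4)) powr q)
          = 2 * W * ((4 * \<tau> k) * (c * B k / (\<tau> k / 4))) powr q"
        using tau(1)[of k] c B[of k] by (subst powr_mult) auto
      also have "(4 * \<tau> k) * (c * B k / (\<tau> k / 4)) = 16 * c * B k" using tau(1)[of k] by simp
      finally show ?thesis using c B[of k] by (simp add: powr_mult mult.assoc)
    qed
    have "(\<Sum>k<N. ennreal ((4 * \<tau> k) powr q) * emeasure \<omega> {x \<in> Q. \<tau> (Suc k) < v x})
        \<le> (\<Sum>k<N. ennreal (2 * W * (16 * c) powr q * B k powr q))" by (intro sum_mono summand)
    also have "\<dots> = ennreal (2 * W * (16 * c) powr q * (\<Sum>k<N. B k powr q))"
      using W by (subst sum_ennreal) (auto simp: sum_distrib_left)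
    also have "\<dots> \<le> ennreal (2 * W * (16 * c) powr q * (2 * A) powr q)"
      using W by (intro ennreal_leI mult_left_mono sum_B) auto
    also have "2 * W * (16 * c) powr q * (2 * A) powr q = 2 * W * (32 * c * A) powr q"
    proof -
      have "(16 * c) powr q * (2 * A) powr q = (32 * c * A) powr q"
        using c A by (subst powr_mult[symmetric]) (auto simp: mult.assoc)
      then show ?thesis by (simp add: mult.assoc)
    qed
    finally show "(\<Sum>k<N. ennreal ((4 * \<tau> k) powr q) * emeasure \<omega> {x \<in> Q. \<tau> (Suc k) < v x}) \<le> ennreal (2 * W * (32 * c * A) powr q)" .
  qed
  also have "\<dots> = ennreal ((2 * T) powr q * W + 2 * W * (32 * c * A) powr q)"
    using W by (simp add: ennreal_mult)
  also have "\<dots> \<le> ennreal (W * (96 * c * A) powr q)"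
  proof (rule ennreal_leI)
    have "(2 * T) powr q \<le> (32 * c * A) powr q" unfolding T_def using c A qp by (intro powr_mono2) auto
    then have "(2 * T) powr q * W + 2 * W * (32 * c * A) powr q \<le> 3 * (W * (32 * c * A) powr q)"
      using W by simp
    also have "\<dots> \<le> 3 powr q * (W * (32 * c * A) powr q)"
      using powr_mono[of 1 q 3] qp W by (intro mult_right_mono) auto
    also have "\<dots> = W * (96 * c * A) powr q"
    proof -
      have "3 powr q * (32 * c * A) powr q = (96 * c * A) powr q"
        using c A by (subst powr_mult[symmetric]) (auto simp: mult.assoc)
      then show ?thesis by simp
    qed
    finally show "(2 * T) powr q * W + 2 * W * (32 * c * A) powr q \<le> W * (96 * c * A) powr q" .
  qed
  finally show ?thesis unfolding v_def q_def c_def .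
qed

end

section \<open>Reduction of the general statement to Borel functions on a half-open cube\<close>

lemma AE_lebesgue_iff: "(AE x in lebesgue. P x) \<longleftrightarrow> (AE x in lborel. P x)"
  by (rule AE_completion_iff)

lemma is_cube_between:
  fixes Q :: "(real ^ 'n) set"
  assumes "is_cube l Q"
  obtains a :: "real ^ 'n" where "0 < l" "box a (a + (\<chi> i. l)) \<subseteq> Q" "Q \<subseteq> cbox a (a + (\<chi> i. l))"
    "AE x in lborel. x \<in> Q \<longleftrightarrow> x \<in> cell a l 0 a"
proof -
  obtain a :: "real ^ 'n" and I where l: "0 < l"
    and I: "\<And>i. {a $ i <..< a $ i + l} \<subseteq> I i" "\<And>i. I i \<subseteq> {a $ i .. a $ i + l}"
    and Q: "Q = {x. \<forall>i. x $ i \<in> I i}"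
    using assms unfolding is_cube_def by blast
  have sub: "box a (a + (\<chi> i. l)) \<subseteq> Q" "Q \<subseteq> cbox a (a + (\<chi> i. l))"
    using I unfolding Q by (auto simp: mem_box_cart subset_iff)
  have c: "cell a l 0 a = {y. \<forall>i. a $ i \<le> y $ i \<and> y $ i < a $ i + l}"
    using cell_eq_half_open[OF l, of a 0 a] by simp
  have sub': "box a (a + (\<chi> i. l)) \<subseteq> cell a l 0 a" "cell a l 0 a \<subseteq> cbox a (a + (\<chi> i. l))"
    unfolding c by (auto simp: mem_box_cart less_imp_le)
  have "AE x in lborel. x \<notin> cbox a (a + (\<chi> i. l)) - box a (a + (\<chi> i. l))"
    by (rule AE_not_in[OF null_cube_boundary[OF l]])
  then have "AE x in lborel. x \<in> Q \<longleftrightarrow> x \<in> cell a l 0 a"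
    by eventually_elim (use sub sub' in blast)
  with l sub show thesis by (rule that)
qed

lemma cube_lebesgue:
  fixes Q :: "(real ^ 'n) set"
  assumes "is_cube l Q"
  shows "Q \<in> sets lebesgue" "emeasure lebesgue Q = ennreal (l ^ CARD('n))"
proof -
  obtain a where l: "0 < l" and sub: "box a (a + (\<chi> i. l)) \<subseteq> Q" "Q \<subseteq> cbox a (a + (\<chi> i. l))"
    using is_cube_between[OF assms] by metis
  have "Q - box a (a + (\<chi> i. l)) \<in> sets lebesgue"
    by (rule null_sets_completion[OF null_cube_boundary[OF l]]) (use sub in blast)
  moreover have "Q = box a (a + (\<chi> i. l)) \<union> (Q - box a (a + (\<chi> i. l)))" using sub by blast
  ultimately show Q: "Q \<in> sets lebesgue" by (metis borel_open open_box sets.Un sets_completionI_sets sets_lborel)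
  have "emeasure lebesgue (box a (a + (\<chi> i. l))) \<le> emeasure lebesgue Q"
    "emeasure lebesgue Q \<le> emeasure lebesgue (cbox a (a + (\<chi> i. l)))"
    by (rule emeasure_mono[OF sub(1) Q], rule emeasure_mono[OF sub(2)]) simp
  then show "emeasure lebesgue Q = ennreal (l ^ CARD('n))"
    using emeasure_cube_box[OF l, of a] emeasure_cube_cbox[OF l, of a] by (simp add: antisym)
qed

lemma locally_integrable_measurable:
  assumes "locally_integrable f"
  shows "f \<in> borel_measurable lebesgue"
proof (rule borel_measurable_LIMSEQ_real)
  show "(\<lambda>x. indicator (cball 0 (real k)) x *\<^sub>R f x) \<in> borel_measurable lebesgue" for k
    using assms unfolding locally_integrable_def set_integrable_def by (auto intro: borel_measurable_integrable)
  show "(\<lambda>k. indicator (cball 0 (real k)) x *\<^sub>R f x) \<longlonglongrightarrow> f x" for x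
  proof (rule tendsto_eventually)
    obtain N where "norm x \<le> real N" using real_arch_simple by blast
    then have "indicator (cball 0 (real k)) x *\<^sub>R f x = f x" if "k \<ge> N" for k
      using that by (auto simp: indicator_def dist_norm intro: order_trans)
    then show "\<forall>\<^sub>F k in sequentially. indicator (cball 0 (real k)) x *\<^sub>R f x = f x"
      unfolding eventually_sequentially by blast
  qed
qed

lemma weighted_measure_cube:
  fixes Q :: "(real ^ 'n) set"
  assumes w: "weight w" and Q: "is_cube l Q"
  shows "weighted_measure w Q < top" "0 < weighted_measure w Q"
proof -
  obtain a where l: "0 < l" and sub: "box a (a + (\<chi> i. l)) \<subseteq> Q" "Q \<subseteq> cbox a (a + (\<chi> i. l))"
    using is_cube_between[OF Q] by metis
  have w': "set_integrable lebesgue (cbox a (a + (\<chi> i. l))) w" and pos: "AE x in lebesgue. 0 < w x"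
    using w unfolding weight_def locally_integrable_def by auto
  have [measurable]: "w \<in> borel_measurable lebesgue"
    using w unfolding weight_def by (auto intro: locally_integrable_measurable)
  have [measurable]: "Q \<in> sets lebesgue" by (rule cube_lebesgue[OF Q])
  have "weighted_measure w Q \<le> (\<integral>\<^sup>+x. ennreal (norm (indicator (cbox a (a + (\<chi> i. l))) x *\<^sub>R w x)) \<partial>lebesgue)"
    unfolding weighted_measure_def using sub
    by (intro nn_integral_mono) (auto simp: indicator_def intro!: ennreal_leI)
  also have "\<dots> < top"
    using w' unfolding set_integrable_def integrable_iff_bounded by simp
  finally show "weighted_measure w Q < top" .
  show "0 < weighted_measure w Q"
  proof (rule ccontr)
    assume "\<not> 0 < weighted_measure w Q"
    then have "(\<integral>\<^sup>+x. ennreal (w x) * indicator Q x \<partial>lebesgue) = 0"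
      by (simp add: weighted_measure_def)
    then have "AE x in lebesgue. ennreal (w x) * indicator Q x = 0"
      by (subst (asm) nn_integral_0_iff_AE) auto
    with pos have "AE x in lebesgue. x \<notin> Q"
      by eventually_elim (auto simp: indicator_def split: if_splits)
    then have "emeasure lebesgue Q = 0" by (subst (asm) AE_iff_measurable[of Q]) auto
    then show False using cube_lebesgue(2)[OF Q] l by simp
  qed
qed

text \<open>The \<open>Liminf\<close> along the almost-everywhere filter only gives \<open>y < f x\<close> almost everywhere for
  each \<open>y\<close> below it; rational values of \<open>y\<close> are enough and leave one null set.\<close>

lemma ess_inf_on_le_AE:
  assumes "Q \<in> sets lebesgue"
  shows "AE x in lebesgue. x \<in> Q \<longrightarrow> ess_inf_on Q f \<le> ennreal (f x)"
proof -
  let ?L = "ess_inf_on Q f"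
  have "\<forall>y<?L. AE x in lebesgue_on Q. y < ennreal (f x)"
    using le_Liminf_iff[of ?L "ae_filter (lebesgue_on Q)" "\<lambda>x. ennreal (f x)"] unfolding ess_inf_on_def by simp
  then have "AE x in lebesgue_on Q. \<forall>r::rat. ennreal (real_of_rat r) < ?L \<longrightarrow> ennreal (real_of_rat r) < ennreal (f x)"
    unfolding AE_all_countable by (intro allI AE_impI) auto
  then have "AE x in lebesgue_on Q. ?L \<le> ennreal (f x)"
  proof eventually_elim
    case (elim x)
    show ?case
    proof (rule ccontr)
      assume "\<not> ?L \<le> ennreal (f x)"
      then obtain r :: rat where "ennreal (f x) < real_of_rat r" "real_of_rat r < ?L"
        using ennreal_rat_dense[of "ennreal (f x)" ?L] unfolding not_le by blast
      then show False using elim by (meson order.asym)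
    qed
  qed
  then show ?thesis using assms by (subst (asm) AE_restrict_space_iff) auto
qed

lemma A1_bound_pointwise:
  fixes P :: "(real ^ 'n) set"
  assumes C: "A1_bound w C" and P: "is_cube s P"
  shows "AE x in lebesgue. x \<in> P \<longrightarrow> weighted_measure w P \<le> ennreal (C * s ^ CARD('n)) * ennreal (w x)"
proof -
  have s: "0 < s" using P by (simp add: is_cube_def)
  have C0: "0 < C" and le: "weighted_measure w P / emeasure lebesgue P \<le> ennreal C * ess_inf_on P w"
    using C P unfolding A1_bound_def by auto
  have "AE x in lebesgue. x \<in> P \<longrightarrow> ess_inf_on P w \<le> ennreal (w x)"
    by (rule ess_inf_on_le_AE[OF cube_lebesgue(1)[OF P]])
  then show ?thesis
  proof eventually_elim
    case (elim x)
    show ?case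
    proof
      assume "x \<in> P"
      then have "weighted_measure w P / ennreal (s ^ CARD('n)) \<le> ennreal C * ennreal (w x)"
        using le elim unfolding cube_lebesgue(2)[OF P]
        by (meson mult_left_mono order_trans zero_le)
      then have "weighted_measure w P / ennreal (s ^ CARD('n)) * ennreal (s ^ CARD('n)) \<le> ennreal C * ennreal (w x) * ennreal (s ^ CARD('n))"
        by (rule mult_right_mono) simp
      also have "weighted_measure w P / ennreal (s ^ CARD('n)) * ennreal (s ^ CARD('n)) = weighted_measure w P"
        using s by (simp add: ennreal_divide_times ennreal_divide_self)
      finally show "weighted_measure w P \<le> ennreal (C * s ^ CARD('n)) * ennreal (w x)"
        using C0 s by (simp add: ennreal_mult mult_ac)
    qed
  qed
qed

text \<open>Integrate the pointwise condition over any cube, here the unit cube, and divide by its weight,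
  which is positive and finite.\<close>

lemma A1_bound_ge_1:
  fixes w :: "real ^ 'n \<Rightarrow> real"
  assumes w: "weight w" and C: "A1_bound w C"
  shows "1 \<le> C"
proof -
  define P where "P = cell (0 :: real ^ 'n) 1 0 0"
  have "is_cube (1 / 2 ^ 0) P" unfolding P_def by (rule is_cube_cell) simp
  then have P: "is_cube 1 P" by simp
  obtain W where W: "weighted_measure w P = ennreal W" "0 < W"
    using weighted_measure_cube[OF w P] by (cases "weighted_measure w P") auto
  have [measurable]: "w \<in> borel_measurable lebesgue"
    using w unfolding weight_def by (auto intro: locally_integrable_measurable)
  have [measurable]: "P \<in> sets lebesgue" by (rule cube_lebesgue[OF P])
  have C0: "0 < C" using C by (simp add: A1_bound_def)
  have "ennreal W = (\<integral>\<^sup>+x. ennreal W * indicator P x \<partial>lebesgue)"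
    using cube_lebesgue[OF P] by (simp add: nn_integral_cmult_indicator)
  also have "\<dots> \<le> (\<integral>\<^sup>+x. ennreal C * (ennreal (w x) * indicator P x) \<partial>lebesgue)"
    using A1_bound_pointwise[OF C P] W(1)
    by (intro nn_integral_mono_AE) (auto elim!: eventually_mono simp: indicator_def)
  also have "\<dots> = ennreal C * ennreal W"
    by (subst nn_integral_cmult) (auto simp: W(1)[unfolded weighted_measure_def])
  finally have "W \<le> C * W" using C0 W by (simp add: ennreal_mult[symmetric])
  then show ?thesis using W by simp
qed

lemma A1_const_ge_1:
  fixes w :: "real ^ 'n \<Rightarrow> real"
  assumes "A1_weight w"
  shows "1 \<le> A1_const w"
  using assms A1_bound_ge_1 unfolding A1_weight_def A1_const_def
  by (intro cInf_greatest) auto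

text \<open>The infimum of the admissible constants is admissible: take the limit along a sequence of them
  outside a common null set.\<close>

lemma A1_const_pointwise:
  fixes P :: "(real ^ 'n) set"
  assumes w: "A1_weight w" and P: "is_cube s P"
  shows "AE x in lebesgue. x \<in> P \<longrightarrow> weighted_measure w P \<le> ennreal (A1_const w * s ^ CARD('n)) * ennreal (w x)"
proof -
  have s: "0 < s" using P by (simp add: is_cube_def)
  have wt: "weight w" using w by (simp add: A1_weight_def)
  have K1: "1 \<le> A1_const w" by (rule A1_const_ge_1[OF w])
  obtain W where W: "weighted_measure w P = ennreal W" "0 < W"
    using weighted_measure_cube[OF wt P] by (cases "weighted_measure w P") auto
  have ne: "{C. A1_bound w C} \<noteq> {}" and bb: "bdd_below {C. A1_bound w C}"
    using w A1_bound_ge_1[OF wt] by (auto simp: A1_weight_def intro!: bdd_belowI[of _ 1])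
  have "\<exists>C. A1_bound w C \<and> C < A1_const w + inverse (real (Suc m))" for m
    using cInf_lessD[OF ne, of "A1_const w + inverse (real (Suc m))"] unfolding A1_const_def by auto
  then obtain C where C: "\<And>m. A1_bound w (C m)" "\<And>m. C m < A1_const w + inverse (real (Suc m))"
    by metis
  have "AE x in lebesgue. \<forall>m. x \<in> P \<longrightarrow> weighted_measure w P \<le> ennreal (C m * s ^ CARD('n)) * ennreal (w x)"
    unfolding AE_all_countable using A1_bound_pointwise[OF C(1) P] by blast
  then show ?thesis
  proof eventually_elim
    case (elim x)
    show ?case
    proof
      assume x: "x \<in> P"
      define z where "z = s ^ CARD('n) * max 0 (w x)"
      have z: "0 \<le> z" using s by (simp add: z_def)
      have wx: "ennreal (c * s ^ CARD('n)) * ennreal (w x) = ennreal (c * z)" if "0 \<le> c" for c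
      proof -
        have "ennreal (w x) = ennreal (max 0 (w x))" by (simp add: max_def ennreal_neg)
        then show ?thesis using that s by (simp add: z_def ennreal_mult[symmetric] mult.assoc)
      qed
      have "W \<le> (A1_const w + inverse (real (Suc m))) * z" for m
      proof -
        have "0 \<le> C m" using C(1)[of m] by (simp add: A1_bound_def)
        then have "ennreal W \<le> ennreal (C m * z)"
          using spec[OF elim, of m] x unfolding W(1) wx[OF \<open>0 \<le> C m\<close>] by simp
        then have "W \<le> C m * z" using z \<open>0 \<le> C m\<close> by simp
        also have "\<dots> \<le> (A1_const w + inverse (real (Suc m))) * z"
          using C(2)[of m] z by (intro mult_right_mono) auto
        finally show ?thesis .
      qed
      moreover have "(\<lambda>m. (A1_const w + inverse (real (Suc m))) * z) \<longlonglongrightarrow> (A1_const w + 0) * z"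
        by (intro tendsto_intros LIMSEQ_inverse_real_of_nat)
      ultimately have "W \<le> A1_const w * z" by (intro LIMSEQ_le_const) auto
      then show "weighted_measure w P \<le> ennreal (A1_const w * s ^ CARD('n)) * ennreal (w x)"
        using W wx[of "A1_const w"] K1 z by simp
    qed
  qed
qed

lemma ennreal_powr_le:
  assumes "X \<le> ennreal b" "0 \<le> b" "0 \<le> r"
  shows "ennreal_powr X r \<le> ennreal (b powr r)"
proof -
  obtain x where x: "X = ennreal x" "0 \<le> x" using assms(1) by (cases X) (auto simp: top_unique)
  then have "x \<le> b" using assms by simp
  then show ?thesis using x assms by (auto simp: ennreal_powr_def intro!: ennreal_leI powr_mono2)
qed

context weighted_fractional_cube
begin

lemma lower_exponent:
  assumes A: "0 < A" and E: "ennreal K * energy \<le> ennreal (A powr p * W)"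
    and r: "1 \<le> r" "r \<le> n / s"
  shows "ennreal_powr ((\<integral>\<^sup>+x\<in>Q. ennreal (\<bar>u x - mean Q u\<bar> powr r) * w x \<partial>lborel) / ennreal W) (1 / r)
    \<le> ennreal (192 * weak_const * A)"
proof -
  define v where "v x = \<bar>u x - mean Q u\<bar>" for x
  define L where "L = 96 * weak_const * A"
  have L: "0 < L" using weak_const_pos A by (simp add: L_def)
  have [measurable]: "v \<in> borel_measurable borel" unfolding v_def by measurable
  have pt: "v x powr r \<le> L powr r + L powr r / L powr (n / s) * v x powr (n / s)" for x
  proof (cases "v x \<le> L")
    case True
    then have "v x powr r \<le> L powr r" using r by (intro powr_mono2) (auto simp: v_def)
    then show ?thesis by (simp add: add_increasing2)
  next
    case False
    then have "1 \<le> v x / L" using L by simp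
    then have "(v x / L) powr r \<le> (v x / L) powr (n / s)" using r by (intro powr_mono) auto
    then have "v x powr r \<le> L powr r / L powr (n / s) * v x powr (n / s)"
      using L by (simp add: powr_divide v_def field_simps)
    then show ?thesis by (simp add: add_increasing)
  qed
  have "(\<integral>\<^sup>+x\<in>Q. ennreal (v x powr r) * w x \<partial>lborel)
     \<le> (\<integral>\<^sup>+x. ennreal (L powr r) * (w x * indicator Q x)
        + ennreal (L powr r / L powr (n / s)) * (ennreal (v x powr (n / s)) * w x * indicator Q x) \<partial>lborel)"
  proof (rule nn_integral_mono)
    fix x :: "real ^ 'n"
    have "ennreal (v x powr r) \<le> ennreal (L powr r) + ennreal (L powr r / L powr (n / s)) * ennreal (v x powr (n / s))"
      using pt[of x] by (simp add: ennreal_mult[symmetric] ennreal_leI flip: ennreal_plus)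
    then have "ennreal (v x powr r) * (w x * indicator Q x) \<le> (ennreal (L powr r) + ennreal (L powr r / L powr (n / s)) * ennreal (v x powr (n / s))) * (w x * indicator Q x)"
      by (rule mult_right_mono) simp
    then show "ennreal (v x powr r) * w x * indicator Q x \<le> ennreal (L powr r) * (w x * indicator Q x)
        + ennreal (L powr r / L powr (n / s)) * (ennreal (v x powr (n / s)) * w x * indicator Q x)"
      by (simp add: distrib_right mult.assoc)
  qed
  also have "\<dots> = ennreal (L powr r) * ennreal W + ennreal (L powr r / L powr (n / s)) * (\<integral>\<^sup>+x\<in>Q. ennreal (v x powr (n / s)) * w x \<partial>lborel)"
    using W by (subst nn_integral_add) (auto simp: nn_integral_cmult)
  also have "\<dots> \<le> ennreal (L powr r) * ennreal W + ennreal (L powr r / L powr (n / s)) * ennreal (W * L powr (n / s))"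
    using strong_type[OF A E] unfolding v_def[symmetric] L_def[symmetric] by (intro add_left_mono mult_left_mono) auto
  also have "\<dots> = ennreal (2 * L powr r * W)"
    using W L by (simp add: ennreal_mult[symmetric] flip: ennreal_plus)
  finally have "(\<integral>\<^sup>+x\<in>Q. ennreal (v x powr r) * w x \<partial>lborel) / ennreal W \<le> ennreal (2 * L powr r * W) / ennreal W"
    by (rule divide_right_mono_ennreal)
  also have "\<dots> = ennreal (2 * L powr r)" using W by (simp add: divide_ennreal)
  finally have "ennreal_powr ((\<integral>\<^sup>+x\<in>Q. ennreal (v x powr r) * w x \<partial>lborel) / ennreal W) (1 / r) \<le> ennreal ((2 * L powr r) powr (1 / r))"
    using r by (intro ennreal_powr_le) auto
  also have "(2 * L powr r) powr (1 / r) \<le> 2 * L"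
  proof -
    have "2 powr (1 / r) \<le> 2 powr 1" using r by (intro powr_mono) auto
    then show ?thesis using L r by (simp add: powr_mult powr_powr)
  qed
  then have "ennreal ((2 * L powr r) powr (1 / r)) \<le> ennreal (192 * weak_const * A)"
    by (intro ennreal_leI) (simp add: L_def)
  finally show ?thesis unfolding v_def .
qed

text \<open>Here \<open>A\<close> is \<open>K\<^bsup>1/p\<^esup> B\<close> for any \<open>B\<close> above \<open>R\<close>, the \<open>p\<close>-th root of the weighted mean energy.
  Letting \<open>B\<close> decrease to \<open>R\<close> covers the case of zero energy, in which \<open>A\<close> must still be positive.\<close>

lemma oscillation_bound:
  assumes r: "1 \<le> r" "r \<le> n / s"
  shows "(INF c. ennreal_powr ((\<integral>\<^sup>+x\<in>Q. ennreal (\<bar>u x - c\<bar> powr r) * w x \<partial>lborel) / ennreal W) (1 / r))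
    \<le> ennreal (1920 * D * (n / s) * (1 - \<delta>) powr (1 / p) * K powr (1 + 1 / p) * l powr \<delta>)
       * ennreal_powr (energy / ennreal W) (1 / p)" (is "?lhs \<le> ennreal ?c * _")
proof -
  have coef: "192 * weak_const * K powr (1 / p) \<le> ?c"
  proof -
    have "K powr (1 / p) \<le> K powr (1 + 1 / p)" using K p by (intro powr_mono) auto
    then have "192 * weak_const * K powr (1 / p) \<le> 192 * weak_const * K powr (1 + 1 / p)"
      using weak_const_pos by (intro mult_left_mono) auto
    then show ?thesis by (simp add: weak_const_def mult_ac)
  qed
  have c: "0 < ?c" using D1 n1 s_pos d l K by simp
  show ?thesis
  proof (cases energy)
    case top
    then have "ennreal_powr (energy / ennreal W) (1 / p) = top"
      by (simp add: ennreal_top_divide ennreal_powr_def)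
    moreover have "ennreal ?c \<noteq> 0" using c by (simp only: ennreal_eq_0_iff not_le)
    ultimately have "ennreal ?c * ennreal_powr (energy / ennreal W) (1 / p) = top"
      by (simp only: ennreal_mult_top if_False)
    then show ?thesis by (simp only: top_greatest)
  next
    case (real e)
    define R where "R = (e / W) powr (1 / p)"
    have eW: "energy / ennreal W = ennreal (e / W)" using real W by (simp add: divide_ennreal)
    have R: "0 \<le> R" by (simp add: R_def)
    have bound: "?lhs \<le> ennreal (?c * B)" if B: "R < B" for B
    proof -
      define A where "A = K powr (1 / p) * B"
      have B0: "0 < B" using R B by linarith
      have A: "0 < A" using K B0 by (simp add: A_def)
      have "e / W = R powr p" unfolding R_def using real W p by (simp add: powr_powr)
      also have "\<dots> \<le> B powr p" using R B p by (intro powr_mono2) auto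
      finally have "K * e \<le> K * (B powr p * W)" using W K by (intro mult_left_mono) (auto simp: field_simps)
      also have "\<dots> = A powr p * W" unfolding A_def using K B0 p by (simp add: powr_mult powr_powr)
      finally have "ennreal K * energy \<le> ennreal (A powr p * W)"
        using real K by (simp add: ennreal_mult[symmetric] ennreal_leI)
      then have "ennreal_powr ((\<integral>\<^sup>+x\<in>Q. ennreal (\<bar>u x - mean Q u\<bar> powr r) * w x \<partial>lborel) / ennreal W) (1 / r)
          \<le> ennreal (192 * weak_const * A)"
        by (rule lower_exponent[OF A _ r])
      also have "\<dots> \<le> ennreal (?c * B)"
        using mult_right_mono[OF coef, of B] B0 by (intro ennreal_leI) (simp add: A_def mult_ac)
      finally show ?thesis by (rule INF_lower2[OF UNIV_I])
    qed
    have "?lhs \<le> ennreal (?c * R) + ennreal \<epsilon>" if "0 < \<epsilon>" for \<epsilon>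
    proof -
      have le: "?lhs \<le> ennreal (?c * (R + \<epsilon> / ?c))" using divide_pos_pos[OF that c] by (intro bound) linarith
      have "k * (R + \<epsilon> / k) = k * R + \<epsilon>" if "0 < k" for k
        using that by (simp add: distrib_left)
      from this[OF c] have "?c * (R + \<epsilon> / ?c) = ?c * R + \<epsilon>" .
      with le have "?lhs \<le> ennreal (?c * R + \<epsilon>)" by (simp only:)
      also have "\<dots> = ennreal (?c * R) + ennreal \<epsilon>"
        by (rule ennreal_plus[OF mult_nonneg_nonneg[OF less_imp_le[OF c] R] less_imp_le[OF that]])
      finally show ?thesis .
    qed
    then have "?lhs \<le> ennreal (?c * R)" by (rule ennreal_le_epsilon)
    also have "\<dots> = ennreal ?c * ennreal_powr (energy / ennreal W) (1 / p)"
    proof -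
      have "ennreal_powr (energy / ennreal W) (1 / p) = ennreal R"
        using eW real W by (simp add: ennreal_powr_def R_def)
      then show ?thesis by (simp only: ennreal_mult[OF less_imp_le[OF c] R])
    qed
    finally show ?thesis .
  qed
qed

end

section \<open>The fractional Poincare--Sobolev inequality with an \<open>A\<^sub>1\<close> weight\<close>

text \<open>The double integral is handled by Tonelli's theorem for \<open>lborel\<close>, which asks for joint
  measurability. The difference \<open>u x - u y\<close> has it when \<open>u\<close> is Borel.\<close>

lemma locally_integrable_borel_version:
  fixes f :: "real ^ 'n \<Rightarrow> real"
  assumes f: "locally_integrable f"
  obtains f' where "f' \<in> borel_measurable borel" "AE x in lborel. f x = f' x"
    "\<And>S. S \<in> sets borel \<Longrightarrow> bounded S \<Longrightarrow> set_integrable lborel S f'"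
proof -
  have fm: "f \<in> borel_measurable lebesgue" by (rule locally_integrable_measurable[OF f])
  then obtain f' where f': "f' \<in> borel_measurable lborel" and eq: "AE x in lborel. f x = f' x"
    using completion_ex_borel_measurable_real[of f lborel] by auto
  have [measurable]: "f' \<in> borel_measurable borel" using f' by simp
  have "set_integrable lborel S f'" if [measurable]: "S \<in> sets borel" and "bounded S" for S
  proof -
    have "compact (closure S)" using \<open>bounded S\<close> by (simp add: compact_eq_bounded_closed bounded_closure)
    then have "set_integrable lebesgue (closure S) f" using f by (simp add: locally_integrable_def)
    then have "set_integrable lebesgue S f"
      by (rule set_integrable_subset) (auto simp: closure_subset)
    then have *: "integrable lebesgue (\<lambda>x. indicator S x *\<^sub>R f x)"
      by (simp add: set_integrable_def)
    have "AE x in lebesgue. indicator S x *\<^sub>R f x = indicator S x *\<^sub>R f' x"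
      using eq unfolding AE_lebesgue_iff by eventually_elim simp
    moreover have "(\<lambda>x. indicator S x *\<^sub>R f' x) \<in> borel_measurable lebesgue"
      by (rule measurable_completion) simp
    ultimately have "integrable lebesgue (\<lambda>x. indicator S x *\<^sub>R f' x)"
      using integrable_cong_AE[OF borel_measurable_integrable[OF *]] * by blast
    then show ?thesis
      unfolding set_integrable_def by (subst (asm) integrable_completion) auto
  qed
  then show thesis using that[of f'] eq by simp
qed

theorem theorem2p1:
  "\<exists>c_n > 0. \<forall>(\<delta> :: real) (p :: real) (w :: real ^ 'n \<Rightarrow> real) (p_star :: real) (p_star_w :: real).
     0 < \<delta> \<and> \<delta> < 1 \<and> 1 \<le> p \<and> p < real CARD('n) / \<delta> \<and> A1_weight w \<and>
     1 / p - 1 / p_star = \<delta> / real CARD('n) \<and>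
     1 / p - 1 / p_star_w = \<delta> / real CARD('n) * (1 / (1 + ln (A1_const w))) \<longrightarrow>
     (\<forall>(Q :: (real ^ 'n) set) (l :: real) (u :: real ^ 'n \<Rightarrow> real).
        is_cube l Q \<and> locally_integrable u \<longrightarrow>
        (INF c :: real.
           ennreal_powr
             ((\<integral>\<^sup>+x\<in>Q. ennreal (\<bar>u x - c\<bar> powr p_star_w) * ennreal (w x) \<partial>lebesgue)
                / weighted_measure w Q)
             (1 / p_star_w))
        \<le> ennreal (c_n * p_star * (1 - \<delta>) powr (1 / p) * A1_const w powr (1 + 1 / p) * l powr \<delta>)
           * ennreal_powr
               ((\<integral>\<^sup>+x\<in>Q.
                   (\<integral>\<^sup>+y\<in>Q. ennreal (\<bar>u x - u y\<bar> powr p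
                        / norm (x - y) powr (real CARD('n) + p * \<delta>)) \<partial>lebesgue)
                   * ennreal (w x) \<partial>lebesgue)
                 / weighted_measure w Q)
               (1 / p))"
proof -
  define n where "n = real CARD('n)"
  define c_n where "c_n = 1920 * (2 powr (n + 2) * (2 * n) powr (n + 1))"
  have n1: "1 \<le> n" by (simp add: n_def Suc_leI)
  have c_n: "0 < c_n" using n1 by (simp add: c_n_def)
  show ?thesis unfolding n_def[symmetric]
  proof (intro exI[of _ c_n] conjI c_n allI impI, elim conjE)
    fix \<delta> p p_star p_star_w l :: real and w u :: "real ^ 'n \<Rightarrow> real" and Q :: "(real ^ 'n) set"
    assume d: "0 < \<delta>" "\<delta> < 1" and p: "1 \<le> p" "p < n / \<delta>" and w: "A1_weight w"
      and p_star: "1 / p - 1 / p_star = \<delta> / n"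
      and p_star_w: "1 / p - 1 / p_star_w = \<delta> / n * (1 / (1 + ln (A1_const w)))"
      and cube: "is_cube l Q" and u: "locally_integrable u"
    define K where "K = A1_const w"
    have K: "1 \<le> K" unfolding K_def by (rule A1_const_ge_1[OF w])
    have wt: "weight w" using w by (simp add: A1_weight_def)
    have sub: "p * \<delta> < n" using p d by (simp add: pos_less_divide_eq)
    have p_star_eq: "p_star = n / (n / p - \<delta>)"
    proof -
      have "1 / p_star = 1 / p - \<delta> / n" using p_star by simp
      also have "\<dots> = (n / p - \<delta>) / n" using n1 by (simp add: diff_divide_distrib)
      finally show ?thesis by (metis inverse_divide inverse_inverse_eq inverse_eq_divide)
    qed
    have exponents: "1 \<le> p_star_w" "p_star_w \<le> p_star"
    proof -
      have h: "0 < 1 / (1 + ln K)" "1 / (1 + ln K) \<le> 1" using ln_ge_zero[OF K] by auto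
      have dn: "0 < \<delta> / n" using d n1 by simp
      have lo: "1 / p - \<delta> / n \<le> 1 / p_star_w"
        using p_star_w h mult_left_mono[OF h(2), of "\<delta> / n"] dn unfolding K_def by simp
      have hi: "1 / p_star_w \<le> 1 / p"
        using p_star_w mult_pos_pos[OF dn h(1)] unfolding K_def by simp
      \<comment> \<open>Subcriticality makes the reciprocal of \<open>p_star\<close> positive, and with it that of \<open>p_star_w\<close>.\<close>
      have "\<delta> / n < 1 / p" using sub p n1 by (simp add: field_simps)
      then have pos: "0 < 1 / p_star" using p_star by linarith
      have lo': "1 / p_star \<le> 1 / p_star_w" using lo p_star by simp
      then have "0 < p_star_w" using pos by (metis less_le_trans zero_less_divide_1_iff)
      then show "p_star_w \<le> p_star" using lo' pos by (simp add: field_simps)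
      have "p \<le> p_star_w" using hi \<open>0 < p_star_w\<close> p by (simp add: field_simps)
      then show "1 \<le> p_star_w" using p by simp
    qed
    obtain a where l: "0 < l" and Q_eq: "AE x in lborel. x \<in> Q \<longleftrightarrow> x \<in> cell a l 0 a"
      using is_cube_between[OF cube] by metis
    obtain u' where u': "u' \<in> borel_measurable borel" and u_eq: "AE x in lborel. u x = u' x"
      and u'_int: "\<And>S. S \<in> sets borel \<Longrightarrow> bounded S \<Longrightarrow> set_integrable lborel S u'"
      using locally_integrable_borel_version[OF u] by blast
    obtain w' where w': "w' \<in> borel_measurable borel" and w_eq: "AE x in lborel. w x = w' x"
      using locally_integrable_borel_version[of w] wt unfolding weight_def by blast
    have transfer: "(\<integral>\<^sup>+x\<in>P. h x \<partial>lebesgue) = (\<integral>\<^sup>+x\<in>P'. h' x \<partial>lborel)"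
      if "AE x in lborel. x \<in> P \<longleftrightarrow> x \<in> P'" "AE x in lborel. h x = h' x" for h h' :: "real ^ 'n \<Rightarrow> ennreal" and P P'
      unfolding nn_integral_completion
      by (rule nn_integral_cong_AE, use that in eventually_elim) (simp add: indicator_def)
    obtain W where W: "weighted_measure w Q = ennreal W" "0 < W"
      using weighted_measure_cube[OF wt cube] by (cases "weighted_measure w Q") auto
    have W': "(\<integral>\<^sup>+x\<in>cell a l 0 a. ennreal (w' x) \<partial>lborel) = ennreal W"
      unfolding W(1)[symmetric] weighted_measure_def
      by (rule transfer[symmetric, OF Q_eq]) (use w_eq in eventually_elim, simp)
    have A1: "AE y in lborel. y \<in> cell a l 0 a \<longrightarrow>
      (\<forall>k. (\<integral>\<^sup>+x\<in>cell a l k y. ennreal (w' x) \<partial>lborel) \<le> ennreal (K * (l / 2 ^ k) powr n) * ennreal (w' y))"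
    proof -
      have "AE y in lborel. y \<in> cell a l k x \<longrightarrow>
        (\<integral>\<^sup>+z\<in>cell a l k x. ennreal (w' z) \<partial>lborel) \<le> ennreal K * emeasure lborel (cell a l k x) * ennreal (w' y)" for k x
      proof -
        have int: "weighted_measure w (cell a l k x) = (\<integral>\<^sup>+z\<in>cell a l k x. ennreal (w' z) \<partial>lborel)"
          unfolding weighted_measure_def by (rule transfer) (simp, use w_eq in eventually_elim, simp)
        have "AE y in lborel. y \<in> cell a l k x \<longrightarrow>
            weighted_measure w (cell a l k x) \<le> ennreal (K * (l / 2 ^ k) ^ CARD('n)) * ennreal (w y)"
          using A1_const_pointwise[OF w is_cube_cell[OF l]] unfolding AE_lebesgue_iff K_def .
        with w_eq show ?thesis
        proof eventually_elim
          case (elim y)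
          have e: "ennreal K * emeasure lborel (cell a l k x) = ennreal (K * (l / 2 ^ k) ^ CARD('n))"
            unfolding emeasure_cell[OF l] using K by (intro ennreal_mult'[symmetric]) auto
          show ?case using elim unfolding int e by simp
        qed
      qed
      then have "AE y in lborel. \<forall>k. (\<integral>\<^sup>+z\<in>cell a l k y. ennreal (w' z) \<partial>lborel)
          \<le> ennreal K * emeasure lborel (cell a l k y) * ennreal (w' y)"
        by (rule AE_all_cells)
      then show ?thesis
      proof eventually_elim
        case (elim y)
        have "ennreal K * emeasure lborel (cell a l k y) = ennreal (K * (l / 2 ^ k) powr n)" for k
          unfolding emeasure_cell[OF l] n_def using K l
          by (subst ennreal_mult'[symmetric]) (auto simp: powr_realpow)
        then show ?case using elim by simp
      qed
    qed
    have bounded_Q: "bounded (cell a l 0 a)"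
      by (rule bounded_subset[OF bounded_cball[of a "n * l"]])
         (use cell_diameter[OF l, of a a 0 a] in \<open>auto simp: n_def dist_norm\<close>)
    interpret V: weighted_fractional_cube n a l \<delta> p u' "\<lambda>x. ennreal (w' x)" K W
      by unfold_locales
         (use l p d sub u' w' W W' K A1 u'_int[OF sets_cell bounded_Q] in \<open>auto simp: n_def\<close>)
    have n_s: "n / V.s = p_star" by (simp add: V.s_def p_star_eq)
    have lhs: "(\<integral>\<^sup>+x\<in>Q. ennreal (\<bar>u x - c\<bar> powr p_star_w) * ennreal (w x) \<partial>lebesgue)
        = (\<integral>\<^sup>+x\<in>cell a l 0 a. ennreal (\<bar>u' x - c\<bar> powr p_star_w) * ennreal (w' x) \<partial>lborel)" for c
      by (rule transfer[OF Q_eq]) (use u_eq w_eq in eventually_elim, simp)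
    have inner: "AE x in lborel. (\<integral>\<^sup>+y\<in>Q. ennreal (\<bar>u x - u y\<bar> powr p / norm (x - y) powr (n + p * \<delta>)) \<partial>lebesgue) = V.g x"
    proof (use u_eq in eventually_elim)
      fix x assume x: "u x = u' x"
      show "(\<integral>\<^sup>+y\<in>Q. ennreal (\<bar>u x - u y\<bar> powr p / norm (x - y) powr (n + p * \<delta>)) \<partial>lebesgue) = V.g x"
        unfolding V.g_def x by (rule transfer[OF Q_eq]) (use u_eq in eventually_elim, simp)
    qed
    have rhs: "(\<integral>\<^sup>+x\<in>Q. (\<integral>\<^sup>+y\<in>Q. ennreal (\<bar>u x - u y\<bar> powr p / norm (x - y) powr (n + p * \<delta>)) \<partial>lebesgue)
        * ennreal (w x) \<partial>lebesgue) = V.energy"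
      unfolding V.energy_def by (rule transfer[OF Q_eq]) (use inner w_eq in eventually_elim, simp)
    have "1920 * V.D = c_n" by (simp add: V.D_def c_n_def)
    then show "(INF c. ennreal_powr ((\<integral>\<^sup>+x\<in>Q. ennreal (\<bar>u x - c\<bar> powr p_star_w) * ennreal (w x) \<partial>lebesgue)
          / weighted_measure w Q) (1 / p_star_w))
        \<le> ennreal (c_n * p_star * (1 - \<delta>) powr (1 / p) * A1_const w powr (1 + 1 / p) * l powr \<delta>)
          * ennreal_powr ((\<integral>\<^sup>+x\<in>Q. (\<integral>\<^sup>+y\<in>Q. ennreal (\<bar>u x - u y\<bar> powr p / norm (x - y) powr (n + p * \<delta>)) \<partial>lebesgue)
             * ennreal (w x) \<partial>lebesgue) / weighted_measure w Q) (1 / p)"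
      unfolding lhs rhs W(1) K_def[symmetric]
      using V.oscillation_bound[of p_star_w] exponents by (simp only: n_s)
  qed
qed

end
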